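(* Let $m_1,\dots,m_n$ be nonnegative integers, $|M|=m_1+\dots+m_n$, and let $k$ be a positive integer with $|M|-2k\ge 0$. For generic $z^0=(z^0_1,\dots,z^0_n)\in Z$, the number of orbits (under permutations of $t_1,\dots,t_k$) of critical points of the function $t\mapsto S(t,z^0)$ is at most $\dim \mathrm{Sing}_k(L^{\otimes M})$.
   Context: $Z=\{z\in\mathbb{C}^n : z_j\ne z_q \text{ for } j\neq q\}$. "Generic $z^0$" means: $z^0$ lies outside a suitable proper algebraic subset of $\mathbb{C}^n$ (depending on $m_1,\dots,m_n,k$). For $t=(t_1,\dots,t_k)\in\mathbb{C}^k$, $z\in Z$ with $t_i\ne z_j$ for all $i,j$ and $t_i\neq t_l$ for $i\ne l$, put $$S(t,z)=\sum_{1\le i<j\le n}\frac{m_im_j}{2}\ln(z_i-z_j)-\sum_{i=1}^k\sum_{l=1}^n m_l\ln(t_i-z_l)+\sum_{1\le i<j\le k}2\ln(t_i-t_j).$$ For fixed $z^0$, the critical points of $S(\cdot,z^0)$ are the points $t$ (with pairwise distinct coordinates, all different from the $z^0_l$) satisfying $\partial S/\partial t_i(t,z^0)=0$, $i=1,\dots,k$, i.e. the Bethe equations $$\sum_{l=1}^n\frac{m_l}{t_i-z^0_l}=\sum_{j\ne i}\frac{2}{t_i-t_j},\qquad i=1,\dots,k.$$ The set of critical points is invariant under the symmetric group permuting $t_1,\dots,t_k$; "orbits" are orbits of this action. $e,f,h$ are the standard generators of $sl_2(\mathbb{C})$: $[e,f]=h$, $[h,e]=2e$, $[h,f]=-2f$.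 $L_m$ is the irreducible $sl_2$-module of highest weight $m$ (dimension $m+1$), $L^{\otimes M}=L_{m_1}\otimes\dots\otimes L_{m_n}$, and $\mathrm{Sing}_k(L^{\otimes M})=\{w\in L^{\otimes M} : ew=0,\ hw=(|M|-2k)w\}$. *)

theory Defs
  imports "HOL-Analysis.Analysis" "HOL-Library.Function_Algebras"
begin

section \<open>Points, algebraic subsets, genericity\<close>

text \<open>A point of \<open>\<complex>\<^sup>n\<close> is an extensional function on \<open>{1..n}\<close>, so that equality of points is
  equality of functions.\<close>

definition cpoints :: "nat \<Rightarrow> (nat \<Rightarrow> complex) set" where
  "cpoints n = {1..n} \<rightarrow>\<^sub>E UNIV"

definition Zset :: "nat \<Rightarrow> (nat \<Rightarrow> complex) set" where
  "Zset n = {z \<in> cpoints n. \<forall>j\<in>{1..n}. \<forall>q\<in>{1..n}. j \<noteq> q \<longrightarrow> z j \<noteq> z q}"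

text \<open>Polynomials in \<open>z\<^sub>1, \<dots>, z\<^sub>n\<close>, viewed as functions: finite combinations of monomials with
  exponent vectors \<open>a\<close>.\<close>

definition is_poly_fun :: "nat \<Rightarrow> ((nat \<Rightarrow> complex) \<Rightarrow> complex) \<Rightarrow> bool" where
  "is_poly_fun n p \<longleftrightarrow>
     (\<exists>A c. finite (A :: (nat \<Rightarrow> nat) set) \<and> p = (\<lambda>z. \<Sum>a\<in>A. c a * (\<Prod>i=1..n. z i ^ a i)))"

definition algebraic_subset :: "nat \<Rightarrow> (nat \<Rightarrow> complex) set \<Rightarrow> bool" where
  "algebraic_subset n X \<longleftrightarrow>
     (\<exists>P. (\<forall>p\<in>P. is_poly_fun n p) \<and> X = {z \<in> cpoints n. \<forall>p\<in>P. p z = 0})"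

definition proper_algebraic_subset :: "nat \<Rightarrow> (nat \<Rightarrow> complex) set \<Rightarrow> bool" where
  "proper_algebraic_subset n X \<longleftrightarrow> algebraic_subset n X \<and> X \<noteq> cpoints n"


section \<open>The function \<open>S\<close> and its critical points\<close>

text \<open>The function \<open>S\<close> is multivalued; near a point of its domain it is determined by a choice of
  a holomorphic branch of the logarithm for each summand. Two choices differ by a locally constant
  function, so the partial derivatives do not depend on the choice
  (see \<open>S_branch_partial_derivative\<close> below).\<close>

definition log_branch :: "(complex \<Rightarrow> complex) \<Rightarrow> complex \<Rightarrow> bool" where
  "log_branch L w \<longleftrightarrow> (\<exists>U. open U \<and> w \<in> U \<and> L holomorphic_on U \<and> (\<forall>u\<in>U. exp (L u) = u))"

definition S_branch ::
  "nat \<Rightarrow> nat \<Rightarrow> (nat \<Rightarrow> nat) \<Rightarrow> (nat \<Rightarrow> complex) \<Rightarrow> (nat \<Rightarrow> complex) \<Rightarrow>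
   ((nat \<Rightarrow> complex) \<Rightarrow> (nat \<Rightarrow> complex) \<Rightarrow> complex) \<Rightarrow> bool" where
  "S_branch n k m t0 z0 S \<longleftrightarrow>
     (\<exists>lzz ltz ltt.
        (\<forall>i\<in>{1..n}. \<forall>j\<in>{1..n}. i < j \<longrightarrow> log_branch (lzz i j) (z0 i - z0 j)) \<and>
        (\<forall>i\<in>{1..k}. \<forall>l\<in>{1..n}. log_branch (ltz i l) (t0 i - z0 l)) \<and>
        (\<forall>i\<in>{1..k}. \<forall>j\<in>{1..k}. i < j \<longrightarrow> log_branch (ltt i j) (t0 i - t0 j)) \<and>
        S = (\<lambda>t z.
          (\<Sum>(i,j) | 1 \<le> i \<and> i < j \<and> j \<le> n.
              (of_nat (m i) * of_nat (m j) / 2) * lzz i j (z i - z j))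
          - (\<Sum>i=1..k. \<Sum>l=1..n. of_nat (m l) * ltz i l (t i - z l))
          + (\<Sum>(i,j) | 1 \<le> i \<and> i < j \<and> j \<le> k. 2 * ltt i j (t i - t j))))"

definition admissible :: "nat \<Rightarrow> nat \<Rightarrow> (nat \<Rightarrow> complex) \<Rightarrow> (nat \<Rightarrow> complex) set" where
  "admissible n k z = {t \<in> cpoints k.
     (\<forall>i\<in>{1..k}. \<forall>j\<in>{1..n}. t i \<noteq> z j) \<and>
     (\<forall>i\<in>{1..k}. \<forall>l\<in>{1..k}. i \<noteq> l \<longrightarrow> t i \<noteq> t l)}"

definition critical_points ::
  "nat \<Rightarrow> nat \<Rightarrow> (nat \<Rightarrow> nat) \<Rightarrow> (nat \<Rightarrow> complex) \<Rightarrow> (nat \<Rightarrow> complex) set" where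
  "critical_points n k m z = {t \<in> admissible n k z.
     \<forall>S. S_branch n k m t z S \<longrightarrow>
       (\<forall>i\<in>{1..k}. ((\<lambda>s. S (t(i := s)) z) has_field_derivative 0) (at (t i)))}"

text \<open>The orbit of \<open>t\<close> under permutations of its coordinates \<open>t\<^sub>1, \<dots>, t\<^sub>k\<close>.\<close>

definition perm_orbit :: "nat \<Rightarrow> (nat \<Rightarrow> complex) \<Rightarrow> (nat \<Rightarrow> complex) set" where
  "perm_orbit k t = {t \<circ> \<sigma> | \<sigma>. \<sigma> permutes {1..k}}"


section \<open>The modules \<open>L\<^sub>m\<close> and their tensor product\<close>

text \<open>Complex-valued functions form a complex vector space under pointwise operations.\<close>

definition cscale :: "complex \<Rightarrow> ('a \<Rightarrow> complex) \<Rightarrow> 'a \<Rightarrow> complex" where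
  "cscale c w = (\<lambda>x. c * w x)"

interpretation cfun: vector_space cscale
  by standard (auto simp: cscale_def algebra_simps fun_eq_iff)

text \<open>\<open>L\<^sub>m\<close> in the basis \<open>v, f v, \<dots>, f\<^sup>m v\<close>, where \<open>v\<close> is a highest weight vector of weight \<open>m\<close>:
  \<open>w j\<close> is the coefficient of \<open>f\<^sup>j v\<close>. The operators are the coordinate form of
  \<open>f (f\<^sup>j v) = f\<^sup>j\<^sup>+\<^sup>1 v\<close> with \<open>f\<^sup>m\<^sup>+\<^sup>1 v = 0\<close>, of \<open>h (f\<^sup>j v) = (m - 2 j) f\<^sup>j v\<close>, and of
  \<open>e (f\<^sup>j v) = j (m - j + 1) f\<^sup>j\<^sup>-\<^sup>1 v\<close>.\<close>

definition Lmod :: "nat \<Rightarrow> (nat \<Rightarrow> complex) set" where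
  "Lmod m = {w. \<forall>j. j \<notin> {0..m} \<longrightarrow> w j = 0}"

definition sl2_e :: "nat \<Rightarrow> (nat \<Rightarrow> complex) \<Rightarrow> nat \<Rightarrow> complex" where
  "sl2_e m w = (\<lambda>j. if j < m then of_nat (j + 1) * of_nat (m - j) * w (j + 1) else 0)"

definition sl2_f :: "nat \<Rightarrow> (nat \<Rightarrow> complex) \<Rightarrow> nat \<Rightarrow> complex" where
  "sl2_f m w = (\<lambda>j. if 1 \<le> j \<and> j \<le> m then w (j - 1) else 0)"

definition sl2_h :: "nat \<Rightarrow> (nat \<Rightarrow> complex) \<Rightarrow> nat \<Rightarrow> complex" where
  "sl2_h m w = (\<lambda>j. if j \<le> m then (of_nat m - 2 * of_nat j) * w j else 0)"

text \<open>Elements of \<open>L\<^sub>m\<^sub>1 \<otimes> \<dots> \<otimes> L\<^sub>m\<^sub>n\<close> are given by their coefficients with respect to the basis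
  \<open>f\<^sup>J\<^sup>1 v\<^sub>1 \<otimes> \<dots> \<otimes> f\<^sup>J\<^sup>n v\<^sub>n\<close>, indexed by \<open>J\<close>.\<close>

definition tens_index :: "nat \<Rightarrow> (nat \<Rightarrow> nat) \<Rightarrow> (nat \<Rightarrow> nat) set" where
  "tens_index n m = (\<Pi>\<^sub>E i\<in>{1..n}. {0..m i})"

definition Ltens :: "nat \<Rightarrow> (nat \<Rightarrow> nat) \<Rightarrow> ((nat \<Rightarrow> nat) \<Rightarrow> complex) set" where
  "Ltens n m = {T. \<forall>J. J \<notin> tens_index n m \<longrightarrow> T J = 0}"

definition pure_tensor ::
  "nat \<Rightarrow> (nat \<Rightarrow> nat) \<Rightarrow> (nat \<Rightarrow> nat \<Rightarrow> complex) \<Rightarrow> (nat \<Rightarrow> nat) \<Rightarrow> complex" where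
  "pure_tensor n m w = (\<lambda>J. if J \<in> tens_index n m then \<Prod>i=1..n. w i (J i) else 0)"

text \<open>\<open>1 \<otimes> \<dots> \<otimes> X \<otimes> \<dots> \<otimes> 1\<close> with \<open>X\<close> in the \<open>i\<close>-th factor, and the action of a Lie algebra
  element, given by its actions \<open>X d\<close> on the modules \<open>L\<^sub>d\<close>, on the tensor product.\<close>

definition slot_action ::
  "nat \<Rightarrow> ((nat \<Rightarrow> complex) \<Rightarrow> nat \<Rightarrow> complex) \<Rightarrow> ((nat \<Rightarrow> nat) \<Rightarrow> complex) \<Rightarrow> (nat \<Rightarrow> nat) \<Rightarrow> complex"
  where "slot_action i X T = (\<lambda>J. X (\<lambda>j. T (J(i := j))) (J i))"

definition tens_action ::
  "nat \<Rightarrow> (nat \<Rightarrow> nat) \<Rightarrow> (nat \<Rightarrow> (nat \<Rightarrow> complex) \<Rightarrow> nat \<Rightarrow> complex) \<Rightarrow>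
   ((nat \<Rightarrow> nat) \<Rightarrow> complex) \<Rightarrow> (nat \<Rightarrow> nat) \<Rightarrow> complex" where
  "tens_action n m X T = (\<lambda>J. if J \<in> tens_index n m
     then \<Sum>i=1..n. slot_action i (X (m i)) T J else 0)"

definition Sing :: "nat \<Rightarrow> nat \<Rightarrow> (nat \<Rightarrow> nat) \<Rightarrow> ((nat \<Rightarrow> nat) \<Rightarrow> complex) set" where
  "Sing k n m = {w \<in> Ltens n m.
     tens_action n m sl2_e w = 0 \<and>
     tens_action n m sl2_h w = cscale (of_nat (\<Sum>i=1..n. m i) - 2 * of_nat k) w}"


section \<open>Basic facts\<close>

subsection \<open>Critical points and the Bethe equations\<close>

lemma log_branch_exists:
  assumes "w \<noteq> 0"
  shows "\<exists>L. log_branch L w"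
proof -
  define L where "L = (\<lambda>u. Ln (u / w) + Ln w)"
  define U where "U = (\<lambda>u. u / w) -` (- \<real>\<^sub>\<le>\<^sub>0)"
  have "open U"
    unfolding U_def by (intro open_vimage continuous_intros) (auto simp: assms)
  moreover have "w \<in> U" using assms by (simp add: U_def)
  moreover have "L holomorphic_on U"
    unfolding L_def U_def using assms by (intro holomorphic_intros) auto
  moreover have "exp (L u) = u" if "u \<in> U" for u
  proof -
    have "u \<noteq> 0" using that by (auto simp: U_def)
    then show ?thesis using assms by (simp add: L_def exp_add)
  qed
  ultimately show ?thesis unfolding log_branch_def by blast
qed

lemma log_branch_derivative:
  assumes "log_branch L w"
  shows "(L has_field_derivative (1 / w)) (at w)"
proof -
  obtain U where U: "open U" "w \<in> U" "L holomorphic_on U" "\<And>u. u \<in> U \<Longrightarrow> exp (L u) = u"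
    using assms unfolding log_branch_def by blast
  obtain D where D: "(L has_field_derivative D) (at w)"
    using U by (meson holomorphic_on_imp_differentiable_at field_differentiable_def)
  have "((\<lambda>u. exp (L u)) has_field_derivative (exp (L w) * D)) (at w)"
    using D by (auto intro!: derivative_eq_intros)
  then have "((\<lambda>u. u) has_field_derivative (w * D)) (at w)"
    using has_field_derivative_transform_within_open[of "\<lambda>u. exp (L u)" _ w U "\<lambda>u. u"] U by auto
  then have "w * D = 1" using DERIV_unique DERIV_ident by blast
  then have "D = 1 / w" by (metis mult_zero_left nonzero_mult_div_cancel_left zero_neq_one)
  with D show ?thesis by simp
qed

lemma S_branch_exists:
  assumes "z \<in> Zset n" "t \<in> admissible n k z"
  shows "\<exists>S. S_branch n k m t z S"
proof -
  define lg where "lg w = (SOME L. log_branch L w)" for w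
  have lg: "log_branch (lg w) w" if "w \<noteq> 0" for w
    unfolding lg_def using log_branch_exists[OF that] by (rule someI_ex)
  show ?thesis
    unfolding S_branch_def
    apply (rule exI, rule exI[of _ "\<lambda>i j. lg (z i - z j)"],
        rule exI[of _ "\<lambda>i l. lg (t i - z l)"], rule exI[of _ "\<lambda>i j. lg (t i - t j)"])
    using assms by (fastforce intro!: lg simp: Zset_def admissible_def)
qed

lemma S_branch_partial_derivative:
  assumes t: "t \<in> admissible n k z" and S: "S_branch n k m t z S" and i: "i \<in> {1..k}"
  shows "((\<lambda>s. S (t(i := s)) z) has_field_derivative
           (\<Sum>j\<in>{1..k} - {i}. 2 / (t i - t j)) - (\<Sum>l=1..n. of_nat (m l) / (t i - z l))) (at (t i))"
proof -
  obtain lzz ltz ltt where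
    ltz: "\<And>i l. i \<in> {1..k} \<Longrightarrow> l \<in> {1..n} \<Longrightarrow> log_branch (ltz i l) (t i - z l)" and
    ltt: "\<And>i j. i \<in> {1..k} \<Longrightarrow> j \<in> {1..k} \<Longrightarrow> i < j \<Longrightarrow> log_branch (ltt i j) (t i - t j)" and
    S_eq: "S = (\<lambda>t z.
          (\<Sum>(i,j) | 1 \<le> i \<and> i < j \<and> j \<le> n.
              (of_nat (m i) * of_nat (m j) / 2) * lzz i j (z i - z j))
          - (\<Sum>i=1..k. \<Sum>l=1..n. of_nat (m l) * ltz i l (t i - z l))
          + (\<Sum>(i,j) | 1 \<le> i \<and> i < j \<and> j \<le> k. 2 * ltt i j (t i - t j)))"
    using S unfolding S_branch_def by blast
  let ?P = "{(p,q). 1 \<le> p \<and> p < q \<and> q \<le> k}"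
  have finP: "finite ?P"
    by (rule finite_subset[of _ "{1..k} \<times> {1..k}"]) auto
  have d1: "((\<lambda>s. of_nat (m l) * ltz p l ((t(i := s)) p - z l)) has_field_derivative
        (if p = i then of_nat (m l) / (t i - z l) else 0)) (at (t i))"
    if "p \<in> {1..k}" "l \<in> {1..n}" for p l
  proof (cases "p = i")
    case True
    have "((\<lambda>s. ltz i l (s - z l)) has_field_derivative 1 / (t i - z l) * 1) (at (t i))"
      by (rule DERIV_chain'[where g = "ltz i l"])
        (use log_branch_derivative[OF ltz[OF i that(2)]] in \<open>auto intro!: derivative_eq_intros\<close>)
    from DERIV_cmult[OF this, of "of_nat (m l)"] show ?thesis using True by simp
  qed auto
  have d2: "((\<lambda>s. 2 * ltt p q ((t(i := s)) p - (t(i := s)) q)) has_field_derivative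
        (if p = i then 2 / (t i - t q) else 0) + (if q = i then 2 / (t i - t p) else 0)) (at (t i))"
    if pq: "1 \<le> p" "p < q" "q \<le> k" for p q
  proof -
    have L: "(ltt p q has_field_derivative 1 / (t p - t q)) (at (t p - t q))"
      using pq by (intro log_branch_derivative ltt) auto
    consider "p = i" "q \<noteq> i" | "q = i" "p \<noteq> i" | "p \<noteq> i" "q \<noteq> i" using pq by force
    then show ?thesis
    proof cases
      case 1
      have "((\<lambda>s. ltt i q (s - t q)) has_field_derivative 1 / (t i - t q) * 1) (at (t i))"
        by (rule DERIV_chain'[where g = "ltt i q"]) (use L 1 in \<open>auto intro!: derivative_eq_intros\<close>)
      from DERIV_cmult[OF this, of 2] show ?thesis using 1 by simp
    next
      case 2
      have "((\<lambda>s. ltt p i (t p - s)) has_field_derivative 1 / (t p - t i) * (- 1)) (at (t i))"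
        by (rule DERIV_chain'[where g = "ltt p i"]) (use L 2 in \<open>auto intro!: derivative_eq_intros\<close>)
      from DERIV_cmult[OF this, of 2]
      have "((\<lambda>s. 2 * ltt p i (t p - s)) has_field_derivative - (2 / (t p - t i))) (at (t i))"
        by simp
      moreover have "- (2 / (t p - t i)) = 2 / (t i - t p)"
        by (metis minus_diff_eq minus_divide_right)
      ultimately show ?thesis using 2 by simp
    qed auto
  qed
  have D1: "((\<lambda>s. \<Sum>p=1..k. \<Sum>l=1..n. of_nat (m l) * ltz p l ((t(i := s)) p - z l))
      has_field_derivative
      (\<Sum>p=1..k. \<Sum>l=1..n. if p = i then of_nat (m l) / (t i - z l) else 0)) (at (t i))"
    by (intro DERIV_sum d1)
  have D2: "((\<lambda>s. \<Sum>x\<in>?P. 2 * ltt (fst x) (snd x) ((t(i := s)) (fst x) - (t(i := s)) (snd x)))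
      has_field_derivative
      (\<Sum>x\<in>?P. (if fst x = i then 2 / (t i - t (snd x)) else 0)
             + (if snd x = i then 2 / (t i - t (fst x)) else 0))) (at (t i))"
    by (intro DERIV_sum d2) auto
  have D: "((\<lambda>s. S (t(i := s)) z) has_field_derivative
      (0 - (\<Sum>p=1..k. \<Sum>l=1..n. if p = i then of_nat (m l) / (t i - z l) else 0)
       + (\<Sum>(p,q)\<in>?P. (if p = i then 2 / (t i - t q) else 0)
                      + (if q = i then 2 / (t i - t p) else 0)))) (at (t i))"
    unfolding S_eq case_prod_unfold
    by (intro DERIV_add DERIV_diff DERIV_const D1 D2[unfolded case_prod_unfold])
  have e1: "(\<Sum>p=1..k. \<Sum>l=1..n. if p = i then of_nat (m l) / (t i - z l) else 0)
          = (\<Sum>l=1..n. of_nat (m l) / (t i - z l))"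
    using i by (subst sum.swap) simp
  have P1: "(\<Sum>(p,q)\<in>?P. if p = i then 2 / (t i - t q) else 0)
          = (\<Sum>q\<in>{i<..k}. 2 / (t i - t q))"
  proof -
    have "(\<Sum>(p,q)\<in>?P. if p = i then 2 / (t i - t q) else 0)
        = (\<Sum>x\<in>Pair i ` {i<..k}. 2 / (t i - t (snd x)))"
      using finP i by (intro sum.mono_neutral_cong_right) auto
    also have "\<dots> = (\<Sum>q\<in>{i<..k}. 2 / (t i - t q))"
      by (subst sum.reindex) (auto simp: inj_on_def)
    finally show ?thesis .
  qed
  have P2: "(\<Sum>(p,q)\<in>?P. if q = i then 2 / (t i - t p) else 0)
          = (\<Sum>p\<in>{1..<i}. 2 / (t i - t p))"
  proof -
    have "(\<Sum>(p,q)\<in>?P. if q = i then 2 / (t i - t p) else 0)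
        = (\<Sum>x\<in>(\<lambda>p. (p, i)) ` {1..<i}. 2 / (t i - t (fst x)))"
      using finP i by (intro sum.mono_neutral_cong_right) auto
    also have "\<dots> = (\<Sum>p\<in>{1..<i}. 2 / (t i - t p))"
      by (subst sum.reindex) (auto simp: inj_on_def)
    finally show ?thesis .
  qed
  have un: "{1..k} - {i} = {i<..k} \<union> {1..<i}" using i by auto
  have "(\<Sum>j\<in>{1..k} - {i}. 2 / (t i - t j))
      = (\<Sum>q\<in>{i<..k}. 2 / (t i - t q)) + (\<Sum>p\<in>{1..<i}. 2 / (t i - t p))"
    unfolding un by (rule sum.union_disjoint) auto
  moreover have "(\<Sum>(p,q)\<in>?P. (if p = i then 2 / (t i - t q) else 0)
                      + (if q = i then 2 / (t i - t p) else 0))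
      = (\<Sum>(p,q)\<in>?P. if p = i then 2 / (t i - t q) else 0)
        + (\<Sum>(p,q)\<in>?P. if q = i then 2 / (t i - t p) else 0)"
    unfolding case_prod_unfold by (rule sum.distrib)
  ultimately have e2: "(\<Sum>(p,q)\<in>?P. (if p = i then 2 / (t i - t q) else 0)
                      + (if q = i then 2 / (t i - t p) else 0))
      = (\<Sum>j\<in>{1..k} - {i}. 2 / (t i - t j))"
    unfolding P1 P2 by (simp only:)
  have arith: "0 - a + b = b - a" for a b :: complex by simp
  show ?thesis using D unfolding e1 e2 arith .
qed

theorem critical_points_eq_Bethe:
  assumes z: "z \<in> Zset n"
  shows "critical_points n k m z = {t \<in> admissible n k z.
    \<forall>i\<in>{1..k}. (\<Sum>l=1..n. of_nat (m l) / (t i - z l)) = (\<Sum>j\<in>{1..k} - {i}. 2 / (t i - t j))}"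
    (is "_ = ?B")
proof (intro equalityI subsetI)
  fix t assume t: "t \<in> critical_points n k m z"
  then have a: "t \<in> admissible n k z" by (simp add: critical_points_def)
  obtain S where S: "S_branch n k m t z S" using S_branch_exists[OF z a] by blast
  have "(\<Sum>l=1..n. of_nat (m l) / (t i - z l)) = (\<Sum>j\<in>{1..k} - {i}. 2 / (t i - t j))"
    if i: "i \<in> {1..k}" for i
  proof -
    have "((\<lambda>s. S (t(i := s)) z) has_field_derivative 0) (at (t i))"
      using t S i by (simp add: critical_points_def)
    from DERIV_unique[OF this S_branch_partial_derivative[OF a S i]] show ?thesis by simp
  qed
  with a show "t \<in> ?B" by blast
next
  fix t assume t: "t \<in> ?B"
  then have a: "t \<in> admissible n k z" by simp
  show "t \<in> critical_points n k m z"
    unfolding critical_points_def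
  proof (intro CollectI conjI a allI impI ballI)
    fix S i assume "S_branch n k m t z S" "i \<in> {1..k}"
    from S_branch_partial_derivative[OF a this] t \<open>i \<in> {1..k}\<close>
    show "((\<lambda>s. S (t(i := s)) z) has_field_derivative 0) (at (t i))" by simp
  qed
qed


subsection \<open>The module \<open>L\<^sub>m\<close>\<close>

lemma Lmod_subspace: "cfun.subspace (Lmod m)"
  by (auto simp: cfun.subspace_def Lmod_def cscale_def)

lemma sl2_closed:
  "sl2_e m w \<in> Lmod m" "sl2_f m w \<in> Lmod m" "sl2_h m w \<in> Lmod m"
  by (auto simp: Lmod_def sl2_e_def sl2_f_def sl2_h_def)

lemma sl2_relations:
  assumes w: "w \<in> Lmod m"
  shows "sl2_e m (sl2_f m w) - sl2_f m (sl2_e m w) = sl2_h m w"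
    and "sl2_h m (sl2_e m w) - sl2_e m (sl2_h m w) = cscale 2 (sl2_e m w)"
    and "sl2_h m (sl2_f m w) - sl2_f m (sl2_h m w) = cscale (-2) (sl2_f m w)"
proof -
  show "sl2_e m (sl2_f m w) - sl2_f m (sl2_e m w) = sl2_h m w"
  proof
    fix j
    show "(sl2_e m (sl2_f m w) - sl2_f m (sl2_e m w)) j = sl2_h m w j"
      by (cases j; cases "j < m"; cases "j = m")
        (auto simp: sl2_e_def sl2_f_def sl2_h_def of_nat_diff algebra_simps)
  qed
  show "sl2_h m (sl2_e m w) - sl2_e m (sl2_h m w) = cscale 2 (sl2_e m w)"
    by (rule ext) (auto simp: sl2_e_def sl2_h_def cscale_def of_nat_diff algebra_simps)
  show "sl2_h m (sl2_f m w) - sl2_f m (sl2_h m w) = cscale (-2) (sl2_f m w)"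
    by (rule ext) (auto simp: sl2_f_def sl2_h_def cscale_def of_nat_diff algebra_simps)
qed

definition delta :: "'a \<Rightarrow> 'a \<Rightarrow> complex" where
  "delta a = (\<lambda>b. if b = a then 1 else 0)"

lemma sum_fun_apply: "(\<Sum>a\<in>A. F a) x = (\<Sum>a\<in>A. (F a x :: complex))"
  by (induction A rule: infinite_finite_induct) auto

lemma delta_expansion:
  assumes "finite I" "\<And>j. j \<notin> I \<Longrightarrow> w j = 0"
  shows "w = (\<Sum>a\<in>I. cscale (w a) (delta a))"
  using assms by (auto simp: fun_eq_iff sum_fun_apply cscale_def delta_def if_distrib cong: if_cong)

lemma delta_independent:
  fixes I :: "'a set"
  shows "cfun.independent (delta ` I)"
  unfolding cfun.independent_explicit_module
proof (intro allI impI)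
  fix A :: "('a \<Rightarrow> complex) set" and u x
  assume A: "finite A" "A \<subseteq> delta ` I" "(\<Sum>x\<in>A. cscale (u x) x) = 0" "x \<in> A"
  then obtain a where a: "x = delta a" by blast
  have "0 = (\<Sum>y\<in>A. u y * y a)"
    using fun_cong[OF A(3), of a] by (simp add: sum_fun_apply cscale_def)
  also have "\<dots> = (\<Sum>y\<in>{x}. u y * y a)"
    using A a by (intro sum.mono_neutral_right) (auto simp: delta_def split: if_splits)
  finally show "u x = 0" by (simp add: a delta_def)
qed

lemma dim_supported:
  fixes I :: "'a set"
  assumes "finite I"
  shows "cfun.dim {w :: _ \<Rightarrow> complex. \<forall>j. j \<notin> I \<longrightarrow> w j = 0} = card I"
proof (rule cfun.dim_unique)
  show "delta ` I \<subseteq> {w. \<forall>j. j \<notin> I \<longrightarrow> w j = 0}" by (auto simp: delta_def)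
  show "{w. \<forall>j. j \<notin> I \<longrightarrow> w j = 0} \<subseteq> cfun.span (delta ` I)"
  proof
    fix w :: "'a \<Rightarrow> complex"
    assume "w \<in> {w. \<forall>j. j \<notin> I \<longrightarrow> w j = 0}"
    then have "w = (\<Sum>a\<in>I. cscale (w a) (delta a))" using delta_expansion assms by blast
    also have "\<dots> \<in> cfun.span (delta ` I)"
      by (intro cfun.span_sum cfun.span_scale cfun.span_base) auto
    finally show "w \<in> cfun.span (delta ` I)" .
  qed
  show "cfun.independent (delta ` I)" by (rule delta_independent)
  show "card (delta ` I) = card I"
    by (rule card_image) (auto simp: inj_on_def delta_def fun_eq_iff split: if_splits)
qed

lemma dim_Lmod: "cfun.dim (Lmod m) = m + 1"
  unfolding Lmod_def by (subst dim_supported) auto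

lemma highest_weight_vector:
  "delta 0 \<in> Lmod m" "sl2_e m (delta 0) = 0" "sl2_h m (delta 0) = cscale (of_nat m) (delta 0)"
  by (auto simp: Lmod_def sl2_e_def sl2_h_def delta_def cscale_def fun_eq_iff)

lemma Lmod_irreducible:
  assumes W: "cfun.subspace W" "W \<subseteq> Lmod m" "W \<noteq> {0}"
    and inv: "\<And>w. w \<in> W \<Longrightarrow> sl2_e m w \<in> W" "\<And>w. w \<in> W \<Longrightarrow> sl2_f m w \<in> W"
  shows "W = Lmod m"
proof -
  have down: "delta 0 \<in> W" if "w \<in> W" "w j \<noteq> 0" "\<And>i. i > j \<Longrightarrow> w i = 0" for w j
    using that
  proof (induction j arbitrary: w)
    case 0
    have "delta 0 = cscale (1 / w 0) w"
      using 0 by (auto simp: fun_eq_iff delta_def cscale_def)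
    then show ?case using cfun.subspace_scale[OF W(1) 0(1)] by simp
  next
    case (Suc j)
    have "Suc j \<le> m" using Suc.prems(1,2) W(2) by (force simp: Lmod_def)
    then have "sl2_e m w j \<noteq> 0" using Suc.prems(2) by (simp add: sl2_e_def del: of_nat_Suc)
    moreover have "sl2_e m w i = 0" if "i > j" for i
      using Suc.prems(3) that by (simp add: sl2_e_def)
    ultimately show ?case using Suc.IH inv(1) Suc.prems(1) by blast
  qed
  obtain w where w: "w \<in> W" "w \<noteq> 0" using W(1,3) cfun.subspace_0 by blast
  have "{j. w j \<noteq> 0} \<subseteq> {0..m}" using w(1) W(2) by (force simp: Lmod_def)
  then have fin: "finite {j. w j \<noteq> 0}" by (rule finite_subset) simp
  have ne: "{j. w j \<noteq> 0} \<noteq> {}" using w(2) by (auto simp: fun_eq_iff)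
  have "delta 0 \<in> W"
  proof (rule down[OF w(1)])
    show "w (Max {j. w j \<noteq> 0}) \<noteq> 0" using Max_in[OF fin ne] by simp
    show "w i = 0" if "i > Max {j. w j \<noteq> 0}" for i
      using that Max_ge[OF fin, of i] by force
  qed
  have d: "delta j \<in> W" if "j \<le> m" for j
    using that
  proof (induction j)
    case (Suc j)
    have "delta (Suc j) = sl2_f m (delta j)"
      using Suc.prems by (auto simp: fun_eq_iff delta_def sl2_f_def)
    then show ?case using Suc inv(2) by simp
  qed (use \<open>delta 0 \<in> W\<close> in auto)
  have "u \<in> W" if "u \<in> Lmod m" for u
  proof -
    have "u = (\<Sum>a\<in>{0..m}. cscale (u a) (delta a))"
      using that by (intro delta_expansion) (auto simp: Lmod_def)
    also have "\<dots> \<in> W"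
      by (intro cfun.subspace_sum cfun.subspace_scale W(1) d) auto
    finally show ?thesis .
  qed
  with W(2) show ?thesis by blast
qed


subsection \<open>The tensor product\<close>

lemma finite_tens_index: "finite (tens_index n m)"
  by (auto simp: tens_index_def intro!: finite_PiE)

lemma dim_Ltens: "cfun.dim (Ltens n m) = (\<Prod>i=1..n. m i + 1)"
  unfolding Ltens_def dim_supported[OF finite_tens_index] by (simp add: tens_index_def card_PiE)

lemma span_pure_tensors:
  "cfun.span {pure_tensor n m w | w. \<forall>i\<in>{1..n}. w i \<in> Lmod (m i)} = Ltens n m"
proof (intro equalityI cfun.span_minimal subsetI)
  show "cfun.subspace (Ltens n m)"
    by (auto simp: cfun.subspace_def Ltens_def cscale_def)
  show "x \<in> Ltens n m" if "x \<in> {pure_tensor n m w | w. \<forall>i\<in>{1..n}. w i \<in> Lmod (m i)}" for x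
    using that by (auto simp: Ltens_def pure_tensor_def)
next
  fix T assume "T \<in> Ltens n m"
  then have "T = (\<Sum>J\<in>tens_index n m. cscale (T J) (delta J))"
    by (intro delta_expansion finite_tens_index) (auto simp: Ltens_def)
  also have "\<dots> \<in> cfun.span {pure_tensor n m w | w. \<forall>i\<in>{1..n}. w i \<in> Lmod (m i)}"
  proof (intro cfun.span_sum cfun.span_scale cfun.span_base)
    fix J assume J: "J \<in> tens_index n m"
    have "delta J K = pure_tensor n m (\<lambda>i. delta (J i)) K" for K
    proof (cases "K \<in> tens_index n m \<and> K \<noteq> J")
      case True
      then obtain i where "i \<in> {1..n}" "K i \<noteq> J i"
        using J unfolding tens_index_def by (meson PiE_ext)
      then have "(\<Prod>i=1..n. delta (J i) (K i)) = 0"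
        by (intro prod_zero) (auto simp: delta_def)
      then show ?thesis using True by (simp add: pure_tensor_def delta_def)
    next
      case False
      then have "K = J \<or> K \<notin> tens_index n m \<and> K \<noteq> J" using J by blast
      then show ?thesis using J by (elim disjE) (simp_all add: pure_tensor_def delta_def)
    qed
    then have "delta J = pure_tensor n m (\<lambda>i. delta (J i))" by (rule ext)
    moreover have "delta (J i) \<in> Lmod (m i)" if "i \<in> {1..n}" for i
    proof -
      have "J i \<in> {0..m i}" using PiE_mem[OF J[unfolded tens_index_def] that] .
      then show ?thesis by (auto simp: Lmod_def delta_def)
    qed
    ultimately show "delta J \<in> {pure_tensor n m w | w. \<forall>i\<in>{1..n}. w i \<in> Lmod (m i)}" by blast
  qed
  finally show "T \<in> cfun.span {pure_tensor n m w | w. \<forall>i\<in>{1..n}. w i \<in> Lmod (m i)}" .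
qed

lemma sl2_scale:
  "sl2_e d (cscale c w) = cscale c (sl2_e d w)"
  "sl2_f d (cscale c w) = cscale c (sl2_f d w)"
  "sl2_h d (cscale c w) = cscale c (sl2_h d w)"
  by (rule ext; simp add: sl2_e_def sl2_f_def sl2_h_def cscale_def mult.left_commute)+

text \<open>The action on pure tensors is
  \<open>X (w\<^sub>1 \<otimes> \<dots> \<otimes> w\<^sub>n) = \<Sum>\<^sub>i w\<^sub>1 \<otimes> \<dots> \<otimes> X w\<^sub>i \<otimes> \<dots> \<otimes> w\<^sub>n\<close>.\<close>

lemma tens_action_pure_tensor:
  assumes X: "\<And>d c u. X d (cscale c u) = cscale c (X d u)"
    and w: "\<forall>i\<in>{1..n}. w i \<in> Lmod (m i)"
  shows "tens_action n m X (pure_tensor n m w)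
       = (\<Sum>i=1..n. pure_tensor n m (w(i := X (m i) (w i))))"
proof
  fix J
  show "tens_action n m X (pure_tensor n m w) J
       = (\<Sum>i=1..n. pure_tensor n m (w(i := X (m i) (w i)))) J"
  proof (cases "J \<in> tens_index n m")
    case J: True
    have "slot_action i (X (m i)) (pure_tensor n m w) J
        = pure_tensor n m (w(i := X (m i) (w i))) J" if i: "i \<in> {1..n}" for i
    proof -
      define c where "c = (\<Prod>l\<in>{1..n} - {i}. w l (J l))"
      have idx: "J(i := j) \<in> tens_index n m \<longleftrightarrow> j \<le> m i" for j
        using J i by (auto simp: tens_index_def PiE_iff extensional_def)
      have "pure_tensor n m w (J(i := j)) = c * w i j" for j
      proof (cases "j \<le> m i")
        case True
        have "(\<Prod>l=1..n. w l ((J(i := j)) l)) = w i j * (\<Prod>l\<in>{1..n} - {i}. w l ((J(i := j)) l))"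
          using i by (subst prod.remove[of _ i]) auto
        also have "(\<Prod>l\<in>{1..n} - {i}. w l ((J(i := j)) l)) = c"
          unfolding c_def by (rule prod.cong) auto
        finally show ?thesis using True idx by (simp add: pure_tensor_def)
      next
        case False
        then show ?thesis using idx w i by (auto simp: pure_tensor_def Lmod_def)
      qed
      then have "slot_action i (X (m i)) (pure_tensor n m w) J = X (m i) (cscale c (w i)) (J i)"
        by (simp add: slot_action_def cscale_def)
      also have "\<dots> = X (m i) (w i) (J i) * c" by (simp add: X) (simp add: cscale_def)
      also have "\<dots> = (\<Prod>l=1..n. (w(i := X (m i) (w i))) l (J l))"
      proof -
        have "(\<Prod>l\<in>{1..n} - {i}. (w(i := X (m i) (w i))) l (J l)) = c"
          unfolding c_def by (rule prod.cong) auto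
        then show ?thesis using i by (subst prod.remove[of _ i]) auto
      qed
      finally show ?thesis using J by (simp add: pure_tensor_def)
    qed
    then show ?thesis using J by (simp add: tens_action_def sum_fun_apply)
  qed (auto simp: tens_action_def pure_tensor_def sum_fun_apply)
qed

end

theory Submission
  imports Defs
begin

text \<open>
  A critical point \<open>t\<close> is determined up to permutation by its set of coordinates \<open>A\<close>. To such a set
  belongs the Bethe vector \<open>f(a\<^sub>1) \<dots> f(a\<^sub>k) v\<close> with \<open>f(a) = \<Sum>\<^sub>l f\<^sub>l / (a - z\<^sub>l)\<close>, where \<open>f\<^sub>l\<close> is \<open>f\<close>
  acting on the \<open>l\<close>-th factor and \<open>v\<close> is the tensor product of the highest weight vectors. The bound
  holds because the Bethe vectors of different orbits are linearly independent in
  \<open>Sing\<^sub>k(L\<^sup>\<otimes>\<^sup>M)\<close>. Four facts give this.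

  The Bethe equations are what makes the unwanted terms cancel in the algebraic Bethe ansatz: the
  Bethe vector is then singular (\<open>e_bethe\<close>) and a joint eigenvector of the Gaudin Hamiltonians
  (\<open>ham_bethe\<close>), where the eigenvalue of the \<open>i\<close>-th Hamiltonian depends on \<open>A\<close> only through
  \<open>m\<^sub>i \<Sum>\<^sub>a 1 / (z\<^sub>i - a)\<close>.

  The Bethe vector is not zero. Each \<open>f(a)\<close> is, up to rescaling of the tensor factors, the
  lowering operator of an \<open>sl\<^sub>2\<close>-triple, so it is injective on vectors of positive weight
  (\<open>lowering_injective\<close>); starting from \<open>v\<close> of weight \<open>|M|\<close> the factors \<open>f(a)\<close> are applied to
  vectors of weights \<open>|M|, |M| - 2, \<dots>, |M| - 2 k + 2\<close>, all positive as \<open>2 k \<le> |M|\<close>.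

  Different sets have different eigenvalues (\<open>bethe_eigenvalues_separate\<close>). The polynomial
  \<open>u(x) = \<Prod>\<^sub>a (x - a)\<close> solves \<open>F u'' + G u' = H u\<close> with \<open>F = \<Prod>\<^sub>l (x - z\<^sub>l)\<close>, \<open>G / F = - \<Sum>\<^sub>l m\<^sub>l / (x - z\<^sub>l)\<close>
  and \<open>deg H < n\<close>, and the eigenvalues prescribe \<open>H\<close> at the \<open>n\<close> points \<open>z\<^sub>l\<close>. So equal eigenvalues mean
  the same equation, and then the Wronskian \<open>w\<close> of the two solutions satisfies \<open>F w' + G w = 0\<close>. A
  nonzero polynomial \<open>w\<close> with this property has degree \<open>|M|\<close>, but the Wronskian of two polynomials
  of degree \<open>k\<close> has degree at most \<open>2 k - 1 < |M|\<close>. Hence \<open>w = 0\<close> and the two root sets agree.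

  Finally, joint eigenvectors with pairwise different eigenvalue systems are linearly independent
  (\<open>joint_eigenvectors_independent\<close>).
\<close>


section \<open>The Bethe ansatz for commuting copies of \<open>sl\<^sub>2\<close>\<close>

text \<open>The commutation relations by which raising and Cartan operators are moved to the right past
  lowering operators, towards a vector on which they act by scalars.\<close>

locale sl2_chain =
  fixes I :: "'i set"
    and e f h :: "'i \<Rightarrow> ('a \<Rightarrow> complex) \<Rightarrow> 'a \<Rightarrow> complex"
  assumes finite_I: "finite I"
    and hom_e: "\<And>i. module_hom cscale cscale (e i)"
    and hom_f: "\<And>i. module_hom cscale cscale (f i)"
    and hom_h: "\<And>i. module_hom cscale cscale (h i)"
    and f_f: "\<And>i j T. f i (f j T) = f j (f i T)"
    and e_f: "\<And>i j T. e i (f j T) = f j (e i T) + (if i = j then h i T else 0)"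
    and h_f: "\<And>i j T. h i (f j T) = f j (h i T) - (if i = j then cscale 2 (f i T) else 0)"
begin

lemmas lin_e = module_hom.add[OF hom_e] module_hom.diff[OF hom_e] module_hom.scale[OF hom_e]
  module_hom.sum[OF hom_e] module_hom.zero[OF hom_e]
lemmas lin_f = module_hom.add[OF hom_f] module_hom.diff[OF hom_f] module_hom.scale[OF hom_f]
  module_hom.sum[OF hom_f] module_hom.zero[OF hom_f]
lemmas lin_h = module_hom.add[OF hom_h] module_hom.diff[OF hom_h] module_hom.scale[OF hom_h]
  module_hom.sum[OF hom_h] module_hom.zero[OF hom_h]

end

locale gaudin_chain = sl2_chain I e f h
  for I :: "'i set" and e f h :: "'i \<Rightarrow> ('a \<Rightarrow> complex) \<Rightarrow> 'a \<Rightarrow> complex" +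
  fixes z :: "'i \<Rightarrow> complex"
begin

text \<open>The generating functions (currents) \<open>f(t)\<close> and \<open>h(t)\<close>, and the Gaudin Hamiltonians
  \<open>\<Sum>\<^sub>j \<Omega>\<^sub>i\<^sub>j / (z\<^sub>i - z\<^sub>j)\<close> with the Casimir tensor \<open>\<Omega> = e \<otimes> f + f \<otimes> e + h \<otimes> h / 2\<close>.\<close>

definition fcur :: "complex \<Rightarrow> ('a \<Rightarrow> complex) \<Rightarrow> 'a \<Rightarrow> complex" where
  "fcur t T = (\<Sum>i\<in>I. cscale (1 / (t - z i)) (f i T))"

definition hcur :: "complex \<Rightarrow> ('a \<Rightarrow> complex) \<Rightarrow> 'a \<Rightarrow> complex" where
  "hcur t T = (\<Sum>i\<in>I. cscale (1 / (t - z i)) (h i T))"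

definition ham :: "'i \<Rightarrow> ('a \<Rightarrow> complex) \<Rightarrow> 'a \<Rightarrow> complex" where
  "ham i T = (\<Sum>j\<in>I - {i}. cscale (1 / (z i - z j))
     (e i (f j T) + f i (e j T) + cscale (1 / 2) (h i (h j T))))"

lemma hom_fcur: "module_hom cscale cscale (fcur t)"
  by (rule module_hom.intro; (rule cfun.module_axioms)?; unfold_locales)
    (simp_all add: fcur_def lin_f sum.distrib cfun.scale_sum_right cfun.scale_right_distrib mult.commute)

lemmas lin_fcur = module_hom.add[OF hom_fcur] module_hom.diff[OF hom_fcur]
  module_hom.scale[OF hom_fcur] module_hom.sum[OF hom_fcur] module_hom.zero[OF hom_fcur]

lemma hom_ham: "module_hom cscale cscale (ham i)"
  by (rule module_hom.intro; (rule cfun.module_axioms)?; unfold_locales)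
    (simp_all add: ham_def lin_e lin_f lin_h sum.distrib cfun.scale_sum_right
      cfun.scale_right_distrib mult.commute add_ac)

lemma f_fcur: "f i (fcur t T) = fcur t (f i T)"
  by (simp add: fcur_def lin_f f_f)

lemma fcur_fcur: "fcur s (fcur t T) = fcur t (fcur s T)"
proof -
  have "fcur s (fcur t T) = (\<Sum>i\<in>I. cscale (1 / (s - z i)) (fcur t (f i T)))"
    by (simp add: fcur_def[of s] f_fcur)
  also have "\<dots> = fcur t (fcur s T)" by (simp add: fcur_def[of s] lin_fcur)
  finally show ?thesis .
qed

lemma e_fcur:
  assumes "i \<in> I"
  shows "e i (fcur t T) = fcur t (e i T) + cscale (1 / (t - z i)) (h i T)"
proof -
  have "e i (fcur t T) = fcur t (e i T) + (\<Sum>j\<in>I. cscale (1 / (t - z j)) (if i = j then h i T else 0))"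
    by (simp add: fcur_def lin_e e_f cfun.scale_right_distrib sum.distrib)
  also have "(\<Sum>j\<in>I. cscale (1 / (t - z j)) (if i = j then h i T else 0))
      = (\<Sum>j\<in>I. if i = j then cscale (1 / (t - z i)) (h i T) else 0)"
    by (intro sum.cong) auto
  also have "\<dots> = cscale (1 / (t - z i)) (h i T)" using assms finite_I by simp
  finally show ?thesis .
qed

lemma h_fcur:
  assumes "i \<in> I"
  shows "h i (fcur t T) = fcur t (h i T) - cscale (2 / (t - z i)) (f i T)"
proof -
  have "h i (fcur t T) = fcur t (h i T) - (\<Sum>j\<in>I. cscale (1 / (t - z j)) (if i = j then cscale 2 (f i T) else 0))"
    by (simp add: fcur_def lin_h h_f cfun.scale_right_diff_distrib sum_subtractf)
  also have "(\<Sum>j\<in>I. cscale (1 / (t - z j)) (if i = j then cscale 2 (f i T) else 0))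
      = (\<Sum>j\<in>I. if i = j then cscale (2 / (t - z i)) (f i T) else 0)"
    by (intro sum.cong) auto
  also have "\<dots> = cscale (2 / (t - z i)) (f i T)" using assms finite_I by simp
  finally show ?thesis .
qed

lemma f_partial_fractions:
  assumes "s \<noteq> t" "s \<notin> z ` I" "t \<notin> z ` I"
  shows "(\<Sum>i\<in>I. cscale (1 / ((s - z i) * (t - z i))) (f i T))
       = cscale (1 / (t - s)) (fcur s T - fcur t T)"
proof -
  have "1 / ((s - z i) * (t - z i)) = 1 / (t - s) * (1 / (s - z i) - 1 / (t - z i))" if "i \<in> I" for i
  proof -
    have "s - z i \<noteq> 0" "t - z i \<noteq> 0" "t - s \<noteq> 0" using assms that by auto
    then show ?thesis by (simp add: diff_frac_eq)
  qed
  then have "(\<Sum>i\<in>I. cscale (1 / ((s - z i) * (t - z i))) (f i T))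
      = (\<Sum>i\<in>I. cscale (1 / (t - s)) (cscale (1 / (s - z i)) (f i T) - cscale (1 / (t - z i)) (f i T)))"
    by (intro sum.cong) (simp_all add: cfun.scale_left_diff_distrib[symmetric])
  then show ?thesis
    by (simp add: fcur_def cfun.scale_sum_right sum_subtractf cfun.scale_right_diff_distrib)
qed

text \<open>Since \<open>[\<Omega>\<^sub>i\<^sub>j, f\<^sub>i] = h\<^sub>i f\<^sub>j - f\<^sub>i h\<^sub>j = - [\<Omega>\<^sub>i\<^sub>j, f\<^sub>j]\<close> for \<open>i \<noteq> j\<close>, the commutator of \<open>\<Omega>\<^sub>i\<^sub>j\<close> with \<open>f(t)\<close> carries
  the factor \<open>1 / (t - z\<^sub>i) - 1 / (t - z\<^sub>j)\<close>, in which the denominator \<open>z\<^sub>i - z\<^sub>j\<close> cancels. The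
  remaining sum over \<open>j\<close> is again expressed by currents.\<close>

lemma ham_fcur:
  assumes i: "i \<in> I" and z: "inj_on z I" and t: "t \<notin> z ` I"
  shows "ham i (fcur t T) = fcur t (ham i T)
    + cscale (1 / (t - z i)) (fcur t (h i T) - f i (hcur t T))"
proof -
  define c where "c j = 1 / (t - z j)" for j
  have step: "cscale (1 / (z i - z j))
      (e i (f j (fcur t T)) + f i (e j (fcur t T)) + cscale (1 / 2) (h i (h j (fcur t T))))
    = fcur t (cscale (1 / (z i - z j)) (e i (f j T) + f i (e j T) + cscale (1 / 2) (h i (h j T))))
      + cscale (c i) (cscale (c j) (f j (h i T)) - cscale (c j) (f i (h j T)))"
    (is "?L = ?R") if j: "j \<in> I - {i}" for j
  proof -
    have ne: "i \<noteq> j" "j \<noteq> i" "j \<in> I" using j by auto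
    have "z i - z j \<noteq> 0" using z i ne by (auto dest: inj_onD)
    moreover have "t - z i \<noteq> 0" "t - z j \<noteq> 0" using t i ne by auto
    ultimately have cc: "c i / (z i - z j) - c j / (z i - z j) = c i * c j"
      unfolding c_def diff_divide_distrib[symmetric] by (simp add: diff_frac_eq)
    have 1: "e i (f j (fcur t T)) = fcur t (e i (f j T)) + cscale (c i) (f j (h i T))"
      using e_fcur[OF i, of t "f j T"] ne by (simp add: f_fcur h_f c_def)
    have 2: "f i (e j (fcur t T)) = fcur t (f i (e j T)) + cscale (c j) (f i (h j T))"
      using e_fcur[OF ne(3), of t T] by (simp add: f_fcur lin_f c_def)
    have "h i (h j (fcur t T)) = h i (fcur t (h j T)) - cscale (2 * c j) (f j (h i T))"
      using h_fcur[OF ne(3), of t T] ne by (simp add: lin_h h_f c_def)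
    then have 3: "h i (h j (fcur t T)) = fcur t (h i (h j T)) - cscale (2 * c i) (f i (h j T))
        - cscale (2 * c j) (f j (h i T))"
      using h_fcur[OF i, of t "h j T"] by (simp add: c_def)
    show ?thesis
    proof
      fix J
      have "?L J - ?R J = (c i / (z i - z j) - c j / (z i - z j) - c i * c j)
          * (f j (h i T) J - f i (h j T) J)"
        unfolding 1 2 3 lin_fcur by (simp add: cscale_def algebra_simps add_divide_distrib diff_divide_distrib)
      then show "?L J = ?R J" unfolding cc by simp
    qed
  qed
  have "ham i (fcur t T) = fcur t (ham i T)
      + (\<Sum>j\<in>I - {i}. cscale (c i) (cscale (c j) (f j (h i T)) - cscale (c j) (f i (h j T))))"
    unfolding ham_def using step by (simp add: lin_fcur sum.distrib)
  \<comment> \<open>The term for \<open>j = i\<close> vanishes, because there the two summands agree.\<close>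
  also have "(\<Sum>j\<in>I - {i}. cscale (c i) (cscale (c j) (f j (h i T)) - cscale (c j) (f i (h j T))))
      = (\<Sum>j\<in>I. cscale (c i) (cscale (c j) (f j (h i T)) - cscale (c j) (f i (h j T))))"
    using finite_I by (intro sum.mono_neutral_left) auto
  also have "\<dots> = cscale (c i) (fcur t (h i T) - f i (hcur t T))"
    by (simp add: fcur_def hcur_def c_def lin_f cfun.scale_sum_right sum_subtractf
        cfun.scale_right_diff_distrib)
  finally show ?thesis unfolding c_def .
qed

text \<open>The currents commute, so the product of the \<open>f(a)\<close> over a finite set does not depend on the
  order of the factors.\<close>

definition bethe :: "('a \<Rightarrow> complex) \<Rightarrow> complex set \<Rightarrow> 'a \<Rightarrow> complex" where
  "bethe v A = Finite_Set.fold fcur v A"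

lemma bethe_empty: "bethe v {} = v"
  by (simp add: bethe_def)

lemma bethe_insert:
  assumes "finite A" "a \<notin> A"
  shows "bethe v (insert a A) = fcur a (bethe v A)"
proof -
  interpret comp_fun_commute fcur
    by standard (auto simp: fun_eq_iff fcur_fcur)
  show ?thesis using assms by (simp add: bethe_def)
qed

lemma bethe_remove:
  assumes "finite A" "a \<in> A"
  shows "fcur a (bethe v (A - {a})) = bethe v A"
  using bethe_insert[of "A - {a}" a v] assms by (simp add: insert_absorb)

definition weight_sum :: "('i \<Rightarrow> complex) \<Rightarrow> complex \<Rightarrow> complex" where
  "weight_sum \<mu> s = (\<Sum>i\<in>I. \<mu> i / (s - z i))"

definition vac_eigenvalue :: "('i \<Rightarrow> complex) \<Rightarrow> 'i \<Rightarrow> complex" where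
  "vac_eigenvalue \<mu> i = (\<Sum>j\<in>I - {i}. \<mu> i * \<mu> j / (2 * (z i - z j)))"

text \<open>From here on \<open>v\<close> is a vacuum, that is, a joint highest weight vector with weights \<open>\<mu>\<close>.\<close>

context
  fixes v :: "'a \<Rightarrow> complex" and \<mu> :: "'i \<Rightarrow> complex"
  assumes z: "inj_on z I"
    and e_v: "\<And>i. i \<in> I \<Longrightarrow> e i v = 0"
    and h_v: "\<And>i. i \<in> I \<Longrightarrow> h i v = cscale (\<mu> i) v"
begin

lemma h_bethe:
  assumes "finite A" "i \<in> I"
  shows "h i (bethe v A) = cscale (\<mu> i) (bethe v A)
    - (\<Sum>b\<in>A. cscale (2 / (b - z i)) (f i (bethe v (A - {b}))))"
  using assms(1)
proof (induction A rule: finite_induct)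
  case empty
  then show ?case by (simp add: bethe_empty h_v assms)
next
  case (insert a A)
  have B: "bethe v (insert a A - {b}) = fcur a (bethe v (A - {b}))" if "b \<in> A" for b
  proof -
    have "insert a A - {b} = insert a (A - {b})" using that insert by auto
    then show ?thesis using bethe_insert[of "A - {b}" a v] insert by simp
  qed
  have "(\<Sum>b\<in>A. cscale (2 / (b - z i)) (f i (bethe v (insert a A - {b}))))
      = fcur a (\<Sum>b\<in>A. cscale (2 / (b - z i)) (f i (bethe v (A - {b}))))"
    by (simp add: B lin_fcur f_fcur del: insert_Diff_if cong: sum.cong)
  then have S: "(\<Sum>b\<in>insert a A. cscale (2 / (b - z i)) (f i (bethe v (insert a A - {b}))))
      = cscale (2 / (a - z i)) (f i (bethe v A))
        + fcur a (\<Sum>b\<in>A. cscale (2 / (b - z i)) (f i (bethe v (A - {b}))))"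
    using insert.hyps by simp
  show ?case
    unfolding S unfolding bethe_insert[OF insert.hyps] h_fcur[OF assms(2)] insert.IH lin_fcur
    by (rule ext) simp
qed

lemma hcur_bethe:
  assumes A: "finite A" "A \<inter> z ` I = {}" and s: "s \<notin> A" "s \<notin> z ` I"
  shows "hcur s (bethe v A) = cscale (weight_sum \<mu> s) (bethe v A)
    - (\<Sum>b\<in>A. cscale (2 / (b - s)) (fcur s (bethe v (A - {b})) - bethe v A))"
proof -
  have inner: "(\<Sum>i\<in>I. cscale (1 / (s - z i)) (cscale (2 / (b - z i)) (f i (bethe v (A - {b})))))
      = cscale (2 / (b - s)) (fcur s (bethe v (A - {b})) - bethe v A)" if b: "b \<in> A" for b
  proof -
    have "(\<Sum>i\<in>I. cscale (1 / (s - z i)) (cscale (2 / (b - z i)) (f i (bethe v (A - {b})))))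
       = cscale 2 (\<Sum>i\<in>I. cscale (1 / ((s - z i) * (b - z i))) (f i (bethe v (A - {b}))))"
      by (simp add: cfun.scale_sum_right)
    also have "\<dots> = cscale 2 (cscale (1 / (b - s)) (fcur s (bethe v (A - {b})) - bethe v A))"
      using b A s by (subst f_partial_fractions) (auto simp: bethe_remove)
    finally show ?thesis by simp
  qed
  have "hcur s (bethe v A) = (\<Sum>i\<in>I. cscale (\<mu> i / (s - z i)) (bethe v A))
     - (\<Sum>i\<in>I. \<Sum>b\<in>A. cscale (1 / (s - z i)) (cscale (2 / (b - z i)) (f i (bethe v (A - {b})))))"
    by (simp add: hcur_def h_bethe[OF A(1)] cfun.scale_right_diff_distrib sum_subtractf
        cfun.scale_sum_right cong: sum.cong)
  also have "(\<Sum>i\<in>I. cscale (\<mu> i / (s - z i)) (bethe v A)) = cscale (weight_sum \<mu> s) (bethe v A)"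
    by (simp add: weight_sum_def cfun.scale_sum_left)
  also have "(\<Sum>i\<in>I. \<Sum>b\<in>A. cscale (1 / (s - z i)) (cscale (2 / (b - z i)) (f i (bethe v (A - {b})))))
     = (\<Sum>b\<in>A. cscale (2 / (b - s)) (fcur s (bethe v (A - {b})) - bethe v A))"
    by (subst sum.swap) (intro sum.cong refl inner)
  finally show ?thesis .
qed

text \<open>The coefficients on the right are the defects of the Bethe equations. When a new point \<open>a\<close> is
  added, \<open>e\<close> commuted past \<open>f(a)\<close> leaves \<open>h(a)\<close>, whose action on the Bethe vector supplies both the
  coefficient of the term without \<open>a\<close> and the missing summand \<open>2 / (b - a)\<close> in the others.\<close>

lemma e_bethe:
  assumes "finite A" "A \<inter> z ` I = {}"
  shows "(\<Sum>i\<in>I. e i (bethe v A))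
    = (\<Sum>a\<in>A. cscale (weight_sum \<mu> a - (\<Sum>b\<in>A - {a}. 2 / (a - b))) (bethe v (A - {a})))"
  using assms
proof (induction A rule: finite_induct)
  case empty
  then show ?case by (simp add: bethe_empty e_v)
next
  case (insert a A)
  define P where "P = bethe v A"
  define Q where "Q b = bethe v (insert a A - {b})" for b
  have Q: "fcur a (bethe v (A - {b})) = Q b" if "b \<in> A" for b
  proof -
    have "insert a A - {b} = insert a (A - {b})" using that insert by auto
    then show ?thesis using bethe_insert[of "A - {b}" a v] insert by (simp add: Q_def)
  qed
  have Qa: "Q a = P" using insert by (simp add: Q_def P_def)
  have ins: "(\<Sum>c\<in>insert a A - {b}. 2 / (b - c)) = 2 / (b - a) + (\<Sum>c\<in>A - {b}. 2 / (b - c))"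
    if "b \<in> A" for b
  proof -
    have "insert a A - {b} = insert a (A - {b})" using that insert by auto
    then show ?thesis using insert by simp
  qed
  have "(\<Sum>i\<in>I. e i (bethe v (insert a A))) = fcur a (\<Sum>i\<in>I. e i P) + hcur a P"
    using insert.hyps by (simp add: bethe_insert e_fcur lin_fcur hcur_def sum.distrib P_def cong: sum.cong)
  also have "fcur a (\<Sum>i\<in>I. e i P) = (\<Sum>b\<in>A. cscale (weight_sum \<mu> b - (\<Sum>c\<in>A - {b}. 2 / (b - c))) (Q b))"
    using insert Q by (simp add: P_def lin_fcur)
  also have "hcur a P = cscale (weight_sum \<mu> a) P - (\<Sum>b\<in>A. cscale (2 / (b - a)) (Q b - P))"
    unfolding P_def using insert Q by (subst hcur_bethe) auto
  also have "(\<Sum>b\<in>A. cscale (weight_sum \<mu> b - (\<Sum>c\<in>A - {b}. 2 / (b - c))) (Q b)) +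
      (cscale (weight_sum \<mu> a) P - (\<Sum>b\<in>A. cscale (2 / (b - a)) (Q b - P)))
    = cscale (weight_sum \<mu> a - (\<Sum>b\<in>A. 2 / (a - b))) P
      + (\<Sum>b\<in>A. cscale (weight_sum \<mu> b - (\<Sum>c\<in>insert a A - {b}. 2 / (b - c))) (Q b))"
  proof
    fix J
    have s: "(\<Sum>b\<in>A. 2 / (a - b)) = - (\<Sum>b\<in>A. 2 / (b - a))"
      by (simp flip: sum_negf) (intro sum.cong refl, simp add: minus_divide_right)
    have 1: "(\<Sum>b\<in>A. (weight_sum \<mu> b - (\<Sum>c\<in>insert a A - {b}. 2 / (b - c))) * Q b J)
       = (\<Sum>b\<in>A. (weight_sum \<mu> b - (\<Sum>c\<in>A - {b}. 2 / (b - c))) * Q b J) - (\<Sum>b\<in>A. 2 / (b - a) * Q b J)"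
      unfolding sum_subtractf[symmetric] by (intro sum.cong refl) (simp only: ins, simp add: algebra_simps)
    have 2: "(\<Sum>b\<in>A. 2 / (b - a) * (Q b J - P J))
       = (\<Sum>b\<in>A. 2 / (b - a) * Q b J) - (\<Sum>b\<in>A. 2 / (b - a)) * P J"
      by (simp add: right_diff_distrib sum_subtractf sum_distrib_right)
    show "((\<Sum>b\<in>A. cscale (weight_sum \<mu> b - (\<Sum>c\<in>A - {b}. 2 / (b - c))) (Q b)) +
        (cscale (weight_sum \<mu> a) P - (\<Sum>b\<in>A. cscale (2 / (b - a)) (Q b - P)))) J
      = (cscale (weight_sum \<mu> a - (\<Sum>b\<in>A. 2 / (a - b))) P
        + (\<Sum>b\<in>A. cscale (weight_sum \<mu> b - (\<Sum>c\<in>insert a A - {b}. 2 / (b - c))) (Q b))) J"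
      unfolding s
      by (simp only: plus_fun_apply minus_apply sum_fun_apply cscale_def 1 2) (simp add: algebra_simps)
  qed
  also have "\<dots> = (\<Sum>b\<in>insert a A. cscale (weight_sum \<mu> b - (\<Sum>c\<in>insert a A - {b}. 2 / (b - c))) (Q b))"
    using insert.hyps Qa by simp
  finally show ?case by (simp add: Q_def)
qed

text \<open>The same defects multiply the vectors by which the Bethe vector fails to be an eigenvector. In
  the induction the corrections from \<open>h\<^sub>i\<close> and from \<open>h(a)\<close> combine by
  \<open>2 / (b - a) - 2 / (b - z\<^sub>i) = 2 (a - z\<^sub>i) / ((b - a) (b - z\<^sub>i))\<close>.\<close>

lemma ham_bethe:
  assumes "finite A" "A \<inter> z ` I = {}" and i: "i \<in> I"
  shows "ham i (bethe v A)
    = cscale (vac_eigenvalue \<mu> i + \<mu> i * (\<Sum>a\<in>A. 1 / (a - z i))) (bethe v A)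
      + (\<Sum>a\<in>A. cscale (((\<Sum>b\<in>A - {a}. 2 / (a - b)) - weight_sum \<mu> a) / (a - z i)) (f i (bethe v (A - {a}))))"
  using assms(1,2)
proof (induction A rule: finite_induct)
  case empty
  have "cscale (1 / (z i - z j)) (e i (f j v) + f i (e j v) + cscale (1 / 2) (h i (h j v)))
      = cscale (\<mu> i * \<mu> j / (2 * (z i - z j))) v" if "j \<in> I - {i}" for j
    using that i by (auto simp: e_f e_v h_v lin_h lin_f mult_ac)
  then have "ham i v = (\<Sum>j\<in>I - {i}. cscale (\<mu> i * \<mu> j / (2 * (z i - z j))) v)"
    unfolding ham_def by (rule sum.cong[OF refl])
  then show ?case
    by (simp add: bethe_empty vac_eigenvalue_def cfun.scale_sum_left)
next
  case (insert a A)
  define P where "P = bethe v A"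
  define Q where "Q b = bethe v (insert a A - {b})" for b
  define R where "R = bethe v (insert a A)"
  define \<epsilon> where "\<epsilon> = vac_eigenvalue \<mu> i + \<mu> i * (\<Sum>b\<in>A. 1 / (b - z i))"
  define g where "g X b = ((\<Sum>c\<in>X - {b}. 2 / (b - c)) - weight_sum \<mu> b) / (b - z i)" for X b
  have R: "R = fcur a P" using insert by (simp add: R_def P_def bethe_insert)
  have Q: "fcur a (bethe v (A - {b})) = Q b" if "b \<in> A" for b
  proof -
    have "insert a A - {b} = insert a (A - {b})" using that insert by auto
    then show ?thesis using bethe_insert[of "A - {b}" a v] insert by (simp add: Q_def)
  qed
  have Qa: "Q a = P" using insert by (simp add: Q_def P_def)
  have g_ins: "g (insert a A) b = g A b + (2 / (b - a) - 2 / (b - z i)) / (a - z i)"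
    if b: "b \<in> A" for b
  proof -
    have "insert a A - {b} = insert a (A - {b})" using b insert by auto
    then have "g (insert a A) b = g A b + 2 / (b - a) / (b - z i)"
      using insert.hyps by (simp add: g_def diff_divide_distrib add_divide_distrib)
    moreover have "2 / (b - a) / (b - z i) = (2 / (b - a) - 2 / (b - z i)) / (a - z i)"
    proof -
      have ne: "b - a \<noteq> 0" "b - z i \<noteq> 0" "a - z i \<noteq> 0" using b insert i by auto
      have "2 / (b - a) - 2 / (b - z i) = 2 * (a - z i) / ((b - a) * (b - z i))"
        unfolding diff_frac_eq[OF ne(1,2)] by (simp add: algebra_simps)
      also have "\<dots> = 2 / (b - a) / (b - z i) * (a - z i)" by simp
      finally show ?thesis by (intro eq_divide_imp[OF ne(3)]) (rule sym)
    qed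
    ultimately show ?thesis by simp
  qed
  have g_a: "g (insert a A) a = ((\<Sum>b\<in>A. 2 / (a - b)) - weight_sum \<mu> a) / (a - z i)"
    using insert.hyps by (simp add: g_def)
  have hP: "fcur a (h i P) = cscale (\<mu> i) R - (\<Sum>b\<in>A. cscale (2 / (b - z i)) (f i (Q b)))"
    unfolding P_def h_bethe[OF insert.hyps(1) i] using Q
    by (simp add: lin_fcur R P_def f_fcur[symmetric])
  have "hcur a P = cscale (weight_sum \<mu> a) P - (\<Sum>b\<in>A. cscale (2 / (b - a)) (Q b - P))"
    unfolding P_def using insert Q by (subst hcur_bethe) auto
  then have fh: "f i (hcur a P)
      = cscale (weight_sum \<mu> a) (f i P) - (\<Sum>b\<in>A. cscale (2 / (b - a)) (f i (Q b) - f i P))"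
    by (simp add: lin_f)
  have hamP: "fcur a (ham i P) = cscale \<epsilon> R + (\<Sum>b\<in>A. cscale (g A b) (f i (Q b)))"
  proof -
    have IH: "ham i P = cscale \<epsilon> P + (\<Sum>b\<in>A. cscale (g A b) (f i (bethe v (A - {b}))))"
      unfolding P_def \<epsilon>_def g_def by (rule insert.IH) (use insert.prems in auto)
    show ?thesis
      unfolding IH lin_fcur R f_fcur[symmetric] by (simp add: Q cong: sum.cong)
  qed
  have "ham i R = fcur a (ham i P) + cscale (1 / (a - z i)) (fcur a (h i P) - f i (hcur a P))"
    unfolding R using insert by (intro ham_fcur i z) auto
  also have "\<dots> = cscale (\<epsilon> + \<mu> i * (1 / (a - z i))) R
      + (cscale (g (insert a A) a) (f i P) + (\<Sum>b\<in>A. cscale (g (insert a A) b) (f i (Q b))))"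
    unfolding hP fh hamP
  proof
    fix J
    have s: "(\<Sum>b\<in>A. 2 / (a - b)) = - (\<Sum>b\<in>A. 2 / (b - a))"
      by (simp flip: sum_negf) (intro sum.cong refl, simp add: minus_divide_right)
    have 1: "(\<Sum>b\<in>A. g (insert a A) b * f i (Q b) J) = (\<Sum>b\<in>A. g A b * f i (Q b) J)
       + (1 / (a - z i)) * ((\<Sum>b\<in>A. 2 / (b - a) * f i (Q b) J) - (\<Sum>b\<in>A. 2 / (b - z i) * f i (Q b) J))"
      unfolding sum_distrib_left sum_subtractf[symmetric] sum.distrib[symmetric]
      by (intro sum.cong refl) (simp add: g_ins algebra_simps diff_divide_distrib)
    have 2: "(\<Sum>b\<in>A. 2 / (b - a) * (f i (Q b) J - f i P J))
       = (\<Sum>b\<in>A. 2 / (b - a) * f i (Q b) J) - (\<Sum>b\<in>A. 2 / (b - a)) * f i P J"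
      by (simp add: right_diff_distrib sum_subtractf sum_distrib_right)
    show "(cscale \<epsilon> R + (\<Sum>b\<in>A. cscale (g A b) (f i (Q b))) +
        cscale (1 / (a - z i)) (cscale (\<mu> i) R - (\<Sum>b\<in>A. cscale (2 / (b - z i)) (f i (Q b))) -
         (cscale (weight_sum \<mu> a) (f i P) - (\<Sum>b\<in>A. cscale (2 / (b - a)) (f i (Q b) - f i P))))) J
      = (cscale (\<epsilon> + \<mu> i * (1 / (a - z i))) R
        + (cscale (g (insert a A) a) (f i P) + (\<Sum>b\<in>A. cscale (g (insert a A) b) (f i (Q b))))) J"
      unfolding g_a s
      by (simp only: plus_fun_apply minus_apply sum_fun_apply cscale_def 1 2)
        (simp add: algebra_simps add_divide_distrib diff_divide_distrib)
  qed
  also have "cscale (g (insert a A) a) (f i P) + (\<Sum>b\<in>A. cscale (g (insert a A) b) (f i (Q b)))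
      = (\<Sum>b\<in>insert a A. cscale (g (insert a A) b) (f i (Q b)))"
    using insert.hyps Qa by simp
  also have "\<epsilon> + \<mu> i * (1 / (a - z i)) = vac_eigenvalue \<mu> i + \<mu> i * (\<Sum>b\<in>insert a A. 1 / (b - z i))"
    using insert.hyps by (simp add: \<epsilon>_def algebra_simps)
  finally show ?case unfolding R_def Q_def g_def .
qed

end
end

section \<open>Polynomials with prescribed simple roots\<close>

definition root_poly :: "complex set \<Rightarrow> complex poly" where
  "root_poly A = (\<Prod>a\<in>A. [:- a, 1:])"

lemma poly_root_poly: "poly (root_poly A) x = (\<Prod>a\<in>A. x - a)"
  by (simp add: root_poly_def poly_prod)

lemma poly_root_poly_eq_0: "finite A \<Longrightarrow> poly (root_poly A) x = 0 \<longleftrightarrow> x \<in> A"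
  by (auto simp: poly_root_poly)

lemma root_poly_monic: "finite A \<Longrightarrow> degree (root_poly A) = card A \<and> lead_coeff (root_poly A) = 1"
proof (induction A rule: finite_induct)
  case (insert a A)
  have eq: "root_poly (insert a A) = [:- a, 1:] * root_poly A"
    unfolding root_poly_def using insert.hyps by (rule prod.insert)
  have "root_poly A \<noteq> 0" using insert.IH by auto
  then have "degree (root_poly (insert a A)) = Suc (card A)"
    unfolding eq using insert.IH by (subst degree_mult_eq) auto
  moreover have "lead_coeff (root_poly (insert a A)) = 1"
    unfolding eq lead_coeff_mult by (simp add: conjunct2[OF insert.IH])
  ultimately show ?case using insert.hyps by simp
qed (simp add: root_poly_def)

lemma pderiv_root_poly_outside:
  assumes "finite A" "x \<notin> A"
  shows "poly (pderiv (root_poly A)) x = poly (root_poly A) x * (\<Sum>a\<in>A. 1 / (x - a))"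
proof -
  have "poly (pderiv (root_poly A)) x = (\<Sum>a\<in>A. \<Prod>b\<in>A - {a}. x - b)"
    by (simp add: root_poly_def pderiv_prod poly_sum poly_prod pderiv_pCons)
  also have "\<dots> = (\<Sum>a\<in>A. (\<Prod>b\<in>A. x - b) * (1 / (x - a)))"
  proof (rule sum.cong[OF refl])
    fix a assume "a \<in> A"
    then show "(\<Prod>b\<in>A - {a}. x - b) = (\<Prod>b\<in>A. x - b) * (1 / (x - a))"
      using assms by (subst prod.remove[of A a]) auto
  qed
  finally show ?thesis by (simp add: poly_root_poly sum_distrib_left)
qed

text \<open>Write \<open>u = (x - a) v\<close>; then \<open>u'(a) = v(a)\<close> and \<open>u''(a) = 2 v'(a)\<close>, and the logarithmic derivative
  of \<open>v\<close> at \<open>a\<close> is the sum on the right. In this form the Bethe equations become a statement about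
  \<open>u'' / u'\<close> at the roots of \<open>u\<close>.\<close>

lemma pderiv_root_poly_inside:
  assumes "finite A" "a \<in> A"
  shows "poly (pderiv (root_poly A)) a \<noteq> 0"
    and "poly (pderiv (pderiv (root_poly A))) a
       = poly (pderiv (root_poly A)) a * (\<Sum>b\<in>A - {a}. 2 / (a - b))"
proof -
  define v where "v = root_poly (A - {a})"
  have u: "root_poly A = [:- a, 1:] * v"
    using assms unfolding v_def root_poly_def by (rule prod.remove)
  have 1: "poly (pderiv (root_poly A)) a = poly v a"
    unfolding u pderiv_mult by (simp add: pderiv_pCons)
  have 2: "poly (pderiv (pderiv (root_poly A))) a = 2 * poly (pderiv v) a"
    unfolding u pderiv_mult pderiv_add by (simp add: pderiv_pCons)
  show "poly (pderiv (root_poly A)) a \<noteq> 0"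
    using assms unfolding 1 by (simp add: v_def poly_root_poly_eq_0)
  have "poly (pderiv v) a = poly v a * (\<Sum>b\<in>A - {a}. 1 / (a - b))"
    unfolding v_def using assms by (intro pderiv_root_poly_outside) auto
  then show "poly (pderiv (pderiv (root_poly A))) a
       = poly (pderiv (root_poly A)) a * (\<Sum>b\<in>A - {a}. 2 / (a - b))"
    unfolding 1 2 by (simp add: sum_distrib_left mult.commute)
qed

lemma root_poly_dvd:
  assumes "finite A" "\<And>a. a \<in> A \<Longrightarrow> poly p a = 0"
  shows "root_poly A dvd p"
  using assms
proof (induction A arbitrary: p rule: finite_induct)
  case (insert a A)
  obtain q where q: "p = [:- a, 1:] * q"
    using insert.prems[of a] by (auto simp: poly_eq_0_iff_dvd)
  have "root_poly A dvd q"
  proof (rule insert.IH)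
    fix b assume "b \<in> A"
    then have "poly p b = 0" "b \<noteq> a" using insert by auto
    then show "poly q b = 0" by (simp add: q)
  qed
  then have "[:- a, 1:] * root_poly A dvd p" unfolding q by (rule mult_dvd_mono[OF dvd_refl])
  then show ?case
    unfolding root_poly_def prod.insert[OF insert.hyps] .
qed (simp add: root_poly_def)

section \<open>The differential equation of a Bethe solution\<close>

text \<open>The Bethe equations say that \<open>F u'' + G u'\<close> vanishes at each root of \<open>u\<close>. The roots are simple, so
  \<open>u\<close> divides it; the quotient \<open>H\<close> has degree below \<open>n\<close> by counting degrees. At \<open>z\<^sub>l\<close> the term with \<open>F\<close>
  drops out and \<open>H(z\<^sub>l) = G(z\<^sub>l) u'(z\<^sub>l) / u(z\<^sub>l)\<close>.\<close>

lemma bethe_ode: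
  fixes z :: "nat \<Rightarrow> complex" and m :: "nat \<Rightarrow> nat" and n :: nat
  defines "F \<equiv> \<Prod>l=1..n. [:- z l, 1:]"
    and "G \<equiv> - (\<Sum>l=1..n. smult (of_nat (m l)) (\<Prod>j\<in>{1..n} - {l}. [:- z j, 1:]))"
  assumes A: "finite A" "A \<inter> z ` {1..n} = {}" "card A \<ge> 1"
    and bethe: "\<And>a. a \<in> A \<Longrightarrow> (\<Sum>l=1..n. of_nat (m l) / (a - z l)) = (\<Sum>b\<in>A - {a}. 2 / (a - b))"
  shows "\<exists>H. F * pderiv (pderiv (root_poly A)) + G * pderiv (root_poly A) = root_poly A * H \<and>
    (H = 0 \<or> degree H < n) \<and>
    (\<forall>l\<in>{1..n}. poly H (z l)
       = - (\<Prod>j\<in>{1..n} - {l}. z l - z j) * (of_nat (m l) * (\<Sum>a\<in>A. 1 / (z l - a))))"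
proof -
  define u where "u = root_poly A"
  have u: "degree u = card A" "lead_coeff u = 1" "u \<noteq> 0"
    using root_poly_monic[OF A(1)] by (auto simp: u_def)
  have G_eq: "poly G a = - poly F a * (\<Sum>l=1..n. of_nat (m l) / (a - z l))" if "a \<in> A" for a
  proof -
    have ne: "a \<noteq> z l" if "l \<in> {1..n}" for l using that \<open>a \<in> A\<close> A(2) by auto
    have "poly G a = - (\<Sum>l=1..n. of_nat (m l) * (\<Prod>j\<in>{1..n} - {l}. a - z j))"
      by (simp add: G_def poly_sum poly_prod)
    also have "(\<Sum>l=1..n. of_nat (m l) * (\<Prod>j\<in>{1..n} - {l}. a - z j))
        = (\<Sum>l=1..n. poly F a * (of_nat (m l) / (a - z l)))"
    proof (rule sum.cong[OF refl])
      fix l assume l: "l \<in> {1..n}"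
      have "poly F a = (a - z l) * (\<Prod>j\<in>{1..n} - {l}. a - z j)"
        unfolding F_def poly_prod using l by (subst prod.remove[of _ l]) simp_all
      then show "of_nat (m l) * (\<Prod>j\<in>{1..n} - {l}. a - z j) = poly F a * (of_nat (m l) / (a - z l))"
        using ne[OF l] by simp
    qed
    finally show ?thesis by (simp add: sum_distrib_left sum_negf)
  qed
  have "root_poly A dvd F * pderiv (pderiv u) + G * pderiv u"
  proof (rule root_poly_dvd[OF A(1)])
    fix a assume a: "a \<in> A"
    show "poly (F * pderiv (pderiv u) + G * pderiv u) a = 0"
      using pderiv_root_poly_inside(2)[OF A(1) a] bethe[OF a] G_eq[OF a]
      by (simp add: u_def algebra_simps)
  qed
  then obtain H where H: "F * pderiv (pderiv u) + G * pderiv u = u * H"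
    by (auto simp: u_def)
  have dF: "degree F \<le> n"
    unfolding F_def using degree_prod_sum_le[of "{1..n}" "\<lambda>l. [:- z l, 1:]"] by simp
  have dG: "degree G \<le> n"
    unfolding G_def degree_minus
  proof (rule degree_sum_le)
    fix l assume "l \<in> {1..n}"
    have "degree (\<Prod>j\<in>{1..n} - {l}. [:- z j, 1:]) \<le> (\<Sum>j\<in>{1..n} - {l}. 1)"
      using degree_prod_sum_le[of "{1..n} - {l}" "\<lambda>l. [:- z l, 1:]"] by simp
    also have "\<dots> \<le> n" using \<open>l \<in> _\<close> by simp
    finally show "degree (smult (of_nat (m l)) (\<Prod>j\<in>{1..n} - {l}. [:- z j, 1:])) \<le> n"
      using degree_smult_le order_trans by blast
  qed simp
  have "degree (u * H) \<le> n + (card A - 1)"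
    unfolding H[symmetric]
  proof (rule degree_add_le)
    show "degree (F * pderiv (pderiv u)) \<le> n + (card A - 1)"
      using degree_mult_le[of F "pderiv (pderiv u)"] dF u(1) by (simp add: degree_pderiv)
    show "degree (G * pderiv u) \<le> n + (card A - 1)"
      using degree_mult_le[of G "pderiv u"] dG u(1) by (simp add: degree_pderiv)
  qed
  then have "H = 0 \<or> degree H < n"
    using u A(3) by (cases "H = 0") (auto simp: degree_mult_eq)
  moreover have "poly H (z l)
      = - (\<Prod>j\<in>{1..n} - {l}. z l - z j) * (of_nat (m l) * (\<Sum>a\<in>A. 1 / (z l - a)))"
    if l: "l \<in> {1..n}" for l
  proof -
    have zl: "z l \<notin> A" using l A(2) by auto
    have "poly F (z l) = 0" using l by (auto simp: F_def poly_prod)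
    moreover have "poly G (z l) = - (of_nat (m l) * (\<Prod>j\<in>{1..n} - {l}. z l - z j))"
    proof -
      have "(\<Prod>j\<in>{1..n} - {q}. z l - z j) = 0" if "q \<noteq> l" for q
        using l that by (intro prod_zero) auto
      then have "(\<Sum>q=1..n. of_nat (m q) * (\<Prod>j\<in>{1..n} - {q}. z l - z j))
          = (\<Sum>q=1..n. if q = l then of_nat (m l) * (\<Prod>j\<in>{1..n} - {l}. z l - z j) else 0)"
        by (intro sum.cong) auto
      then show ?thesis using l by (simp add: G_def poly_sum poly_prod)
    qed
    ultimately have "poly u (z l) * poly H (z l)
        = poly u (z l) * (- (\<Prod>j\<in>{1..n} - {l}. z l - z j) * (of_nat (m l) * (\<Sum>a\<in>A. 1 / (z l - a))))"
      using arg_cong[OF H, of "\<lambda>p. poly p (z l)"] pderiv_root_poly_outside[OF A(1) zl]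
      by (simp add: u_def[symmetric] mult_ac)
    moreover have "poly u (z l) \<noteq> 0" using zl A(1) by (simp add: u_def poly_root_poly_eq_0)
    ultimately show ?thesis using mult_left_cancel by blast
  qed
  ultimately show ?thesis using H unfolding u_def by blast
qed

text \<open>The numbers compared in the last hypothesis are, up to sign and a part common to all sets, the
  eigenvalues
  of the Gaudin Hamiltonians on Bethe vectors.\<close>

lemma bethe_eigenvalues_separate:
  fixes z :: "nat \<Rightarrow> complex" and m :: "nat \<Rightarrow> nat"
  assumes z: "inj_on z {1..n}"
    and A: "finite A" "A \<inter> z ` {1..n} = {}" "card A \<ge> 1"
    and B: "finite B" "B \<inter> z ` {1..n} = {}" "card B \<ge> 1"
    and deg: "card A + card B \<le> (\<Sum>i=1..n. m i)"
    and bA: "\<And>a. a \<in> A \<Longrightarrow> (\<Sum>l=1..n. of_nat (m l) / (a - z l)) = (\<Sum>b\<in>A - {a}. 2 / (a - b))"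
    and bB: "\<And>a. a \<in> B \<Longrightarrow> (\<Sum>l=1..n. of_nat (m l) / (a - z l)) = (\<Sum>b\<in>B - {a}. 2 / (a - b))"
    and eq: "\<And>l. l \<in> {1..n} \<Longrightarrow>
      of_nat (m l) * (\<Sum>a\<in>A. 1 / (z l - a)) = of_nat (m l) * (\<Sum>a\<in>B. 1 / (z l - a))"
  shows "A = B"
proof -
  define F where "F = (\<Prod>l=1..n. [:- z l, 1:])"
  define G where "G = - (\<Sum>l=1..n. smult (of_nat (m l)) (\<Prod>j\<in>{1..n} - {l}. [:- z j, 1:]))"
  define u where "u = root_poly A"
  define v where "v = root_poly B"
  obtain H where H: "F * pderiv (pderiv u) + G * pderiv u = u * H" "H = 0 \<or> degree H < n"
    "\<And>l. l \<in> {1..n} \<Longrightarrow> poly H (z l)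
       = - (\<Prod>j\<in>{1..n} - {l}. z l - z j) * (of_nat (m l) * (\<Sum>a\<in>A. 1 / (z l - a)))"
    using bethe_ode[OF A bA] unfolding F_def G_def u_def by blast
  obtain K where K: "F * pderiv (pderiv v) + G * pderiv v = v * K" "K = 0 \<or> degree K < n"
    "\<And>l. l \<in> {1..n} \<Longrightarrow> poly K (z l)
       = - (\<Prod>j\<in>{1..n} - {l}. z l - z j) * (of_nat (m l) * (\<Sum>a\<in>B. 1 / (z l - a)))"
    using bethe_ode[OF B bB] unfolding F_def G_def v_def by blast
  have M: "(\<Sum>i=1..n. m i) > 0" using deg A(3) by simp
  then have n: "n > 0" by (cases n) auto
  have HK: "H = K"
  proof (rule ccontr)
    assume "H \<noteq> K"
    then have ne: "H - K \<noteq> 0" by simp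
    have "z ` {1..n} \<subseteq> {x. poly (H - K) x = 0}" using H(3) K(3) eq by auto
    then have "card (z ` {1..n}) \<le> card {x. poly (H - K) x = 0}"
      using poly_roots_finite[OF ne] by (intro card_mono)
    also have "\<dots> \<le> degree (H - K)" using ne by (rule card_poly_roots_bound)
    also have "\<dots> < n"
      using H(2) K(2) n by (intro degree_diff_less) auto
    finally show False using z by (simp add: card_image)
  qed
  define w where "w = u * pderiv v - pderiv u * v"
  have "F * pderiv w + G * w
      = u * (F * pderiv (pderiv v) + G * pderiv v) - v * (F * pderiv (pderiv u) + G * pderiv u)"
    by (simp add: w_def pderiv_diff pderiv_mult algebra_simps)
  also have "\<dots> = 0" unfolding H(1) K(1) HK by (simp add: mult.left_commute)
  finally have ode: "F * pderiv w = - (G * w)" by (rule eq_neg_iff_add_eq_0[THEN iffD2])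
  \<comment> \<open>Compare leading coefficients in \<open>F w' = - G w\<close>: \<open>F\<close> is monic of degree \<open>n\<close>, and \<open>G\<close> has leading
    coefficient \<open>- |M|\<close> in degree \<open>n - 1\<close>, so the degree of \<open>w\<close> must be \<open>|M|\<close>.\<close>
  have "w = 0"
  proof (rule ccontr)
    assume w: "w \<noteq> 0"
    have F: "degree F = n" "lead_coeff F = 1"
    proof -
      have "F = root_poly (z ` {1..n})"
        unfolding F_def root_poly_def prod.reindex[OF z] by simp
      then show "degree F = n" "lead_coeff F = 1"
        using root_poly_monic[of "z ` {1..n}"] z by (auto simp: card_image)
    qed
    have T: "degree (\<Prod>j\<in>{1..n} - {l}. [:- z j, 1:]) = n - 1"
      "coeff (\<Prod>j\<in>{1..n} - {l}. [:- z j, 1:]) (n - 1) = 1" if l: "l \<in> {1..n}" for l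
    proof -
      have inj: "inj_on z ({1..n} - {l})" using z by (rule inj_on_subset) auto
      have "(\<Prod>j\<in>{1..n} - {l}. [:- z j, 1:]) = root_poly (z ` ({1..n} - {l}))"
        unfolding root_poly_def prod.reindex[OF inj] by simp
      then show "degree (\<Prod>j\<in>{1..n} - {l}. [:- z j, 1:]) = n - 1"
        "coeff (\<Prod>j\<in>{1..n} - {l}. [:- z j, 1:]) (n - 1) = 1"
        using root_poly_monic[of "z ` ({1..n} - {l})"] inj l by (auto simp: card_image)
    qed
    have cG: "coeff G (n - 1) = - of_nat (\<Sum>i=1..n. m i)"
    proof -
      have "coeff G (n - 1)
          = - (\<Sum>l=1..n. of_nat (m l) * coeff (\<Prod>j\<in>{1..n} - {l}. [:- z j, 1:]) (n - 1))"
        by (simp add: G_def coeff_sum)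
      also have "(\<Sum>l=1..n. of_nat (m l) * coeff (\<Prod>j\<in>{1..n} - {l}. [:- z j, 1:]) (n - 1))
          = (\<Sum>l=1..n. of_nat (m l))"
        by (intro sum.cong refl) (simp only: T mult_1_right)
      finally show ?thesis by simp
    qed
    then have "coeff G (n - 1) \<noteq> 0" using M by (simp only: neg_equal_0_iff_equal of_nat_eq_0_iff)
    moreover have "degree G \<le> n - 1"
      unfolding G_def degree_minus
      by (rule degree_sum_le) (use T(1) degree_smult_le in \<open>auto intro: order_trans\<close>)
    ultimately have dG: "degree G = n - 1" "G \<noteq> 0" by (auto intro: antisym le_degree)
    have w': "pderiv w \<noteq> 0" using ode dG(2) w by auto
    then have d: "degree w > 0" using pderiv_eq_0_iff by blast
    have "lead_coeff (F * pderiv w) = of_nat (degree w) * lead_coeff w"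
      using d F(2) by (simp only: lead_coeff_mult) (simp add: degree_pderiv coeff_pderiv)
    moreover have "lead_coeff (- (G * w)) = of_nat (\<Sum>i=1..n. m i) * lead_coeff w"
      using cG dG by (simp add: lead_coeff_mult)
    ultimately have "of_nat (degree w) * lead_coeff w = of_nat (\<Sum>i=1..n. m i) * lead_coeff w"
      by (simp only: ode)
    then have "of_nat (degree w) = (of_nat (\<Sum>i=1..n. m i) :: complex)"
      using w mult_right_cancel leading_coeff_0_iff by blast
    then have "degree w = (\<Sum>i=1..n. m i)" using of_nat_eq_iff by blast
    moreover have "degree w \<le> card A + card B - 1"
      unfolding w_def
    proof (rule degree_diff_le)
      have u: "degree u = card A" "degree v = card B"
        using root_poly_monic A(1) B(1) by (auto simp: u_def v_def)
      show "degree (u * pderiv v) \<le> card A + card B - 1"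
        using degree_mult_le[of u "pderiv v"] u A(3) B(3) by (simp add: degree_pderiv)
      show "degree (pderiv u * v) \<le> card A + card B - 1"
        using degree_mult_le[of "pderiv u" v] u A(3) B(3) by (simp add: degree_pderiv)
    qed
    ultimately show False using deg A(3) by linarith
  qed
  then have wr: "poly u a * poly (pderiv v) a = poly (pderiv u) a * poly v a" for a
    unfolding w_def by (metis eq_iff_diff_eq_0 poly_mult)
  have roots: "poly u a = 0 \<longleftrightarrow> a \<in> A" "poly v a = 0 \<longleftrightarrow> a \<in> B" for a
    unfolding u_def v_def using A(1) B(1) by (simp_all add: poly_root_poly_eq_0)
  have simple: "poly (pderiv u) a \<noteq> 0" if "a \<in> A" for a
    unfolding u_def using A(1) that by (rule pderiv_root_poly_inside(1))
  have "poly (pderiv v) a \<noteq> 0" if "a \<in> B" for a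
    unfolding v_def using B(1) that by (rule pderiv_root_poly_inside(1))
  with simple wr roots show "A = B" by (metis mult_eq_0_iff subsetI subset_antisym)
qed

section \<open>The tensor product as a module over commuting copies of \<open>sl\<^sub>2\<close>\<close>

definition slot_e where "slot_e m i = slot_action i (sl2_e (m i))" for m :: "nat \<Rightarrow> nat"
definition slot_f where "slot_f m i = slot_action i (sl2_f (m i))" for m :: "nat \<Rightarrow> nat"
definition slot_h where "slot_h m i = slot_action i (sl2_h (m i))" for m :: "nat \<Rightarrow> nat"

lemma slot_e_apply: "slot_e m i T J =
    (if J i < m i then of_nat (J i + 1) * of_nat (m i - J i) * T (J(i := J i + 1)) else 0)"
  by (simp add: slot_e_def slot_action_def sl2_e_def)

lemma slot_f_apply: "slot_f m i T J = (if 1 \<le> J i \<and> J i \<le> m i then T (J(i := J i - 1)) else 0)"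
  by (simp add: slot_f_def slot_action_def sl2_f_def)

lemma slot_h_apply: "slot_h m i T J = (if J i \<le> m i then (of_nat (m i) - 2 * of_nat (J i)) * T J else 0)"
  by (simp add: slot_h_def slot_action_def sl2_h_def)

lemma module_hom_cscaleI:
  assumes "\<And>S T. g (S + T) = g S + g T" "\<And>c T. g (cscale c T) = cscale c (g T)"
  shows "module_hom cscale cscale g"
  using assms by (intro module_hom.intro cfun.module_axioms module_hom_axioms.intro)

text \<open>The truncation in \<open>sl2_f\<close> and \<open>sl2_h\<close> above index \<open>m i\<close> makes the relations hold for arbitrary
  coefficient functions: at \<open>J i = m i\<close> the factor \<open>m i - J i\<close> of \<open>e f\<close> vanishes, and above it all
  operators give \<open>0\<close>.\<close>

lemma sl2_chain_slots: "sl2_chain {1..n} (slot_e m) (slot_f m) (slot_h m)"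
proof (rule sl2_chain.intro)
  show "module_hom cscale cscale (slot_e m i)" for i
    by (rule module_hom_cscaleI) (auto simp: fun_eq_iff slot_e_apply cscale_def algebra_simps)
  show "module_hom cscale cscale (slot_f m i)" for i
    by (rule module_hom_cscaleI) (auto simp: fun_eq_iff slot_f_apply cscale_def algebra_simps)
  show "module_hom cscale cscale (slot_h m i)" for i
    by (rule module_hom_cscaleI) (auto simp: fun_eq_iff slot_h_apply cscale_def algebra_simps)
  show "slot_f m i (slot_f m j T) = slot_f m j (slot_f m i T)" for i j T
    by (cases "i = j") (auto simp: fun_eq_iff slot_f_apply fun_upd_twist fun_upd_idem)
  show "slot_e m i (slot_f m j T) = slot_f m j (slot_e m i T) + (if i = j then slot_h m i T else 0)" for i j T
  proof (cases "i = j")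
    case True
    show ?thesis
    proof
      fix J
      consider "J i = 0" | "1 \<le> J i" "J i < m i" | "1 \<le> J i" "J i = m i" | "J i > m i" by linarith
      then show "slot_e m i (slot_f m j T) J
          = (slot_f m j (slot_e m i T) + (if i = j then slot_h m i T else 0)) J"
        using True by cases (auto simp: slot_e_apply slot_f_apply slot_h_apply of_nat_diff algebra_simps fun_upd_idem)
    qed
  qed (auto simp: fun_eq_iff slot_e_apply slot_f_apply fun_upd_twist)
  show "slot_h m i (slot_f m j T)
      = slot_f m j (slot_h m i T) - (if i = j then cscale 2 (slot_f m i T) else 0)" for i j T
    by (cases "i = j")
      (auto simp: fun_eq_iff slot_h_apply slot_f_apply cscale_def of_nat_diff algebra_simps)
qed simp

text \<open>The weight space of weight \<open>|M| - 2 d\<close>. It is described by the total degree \<open>d\<close> of the basis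
  vectors, which makes it evident that the raising operators are nilpotent.\<close>

definition Ldeg :: "nat \<Rightarrow> (nat \<Rightarrow> nat) \<Rightarrow> nat \<Rightarrow> ((nat \<Rightarrow> nat) \<Rightarrow> complex) set" where
  "Ldeg n m d = {T. \<forall>J. T J \<noteq> 0 \<longrightarrow> J \<in> tens_index n m \<and> (\<Sum>i=1..n. J i) = d}"

lemma Ldeg_subspace: "cfun.subspace (Ldeg n m d)"
proof (rule cfun.subspaceI)
  fix S T assume ST: "S \<in> Ldeg n m d" "T \<in> Ldeg n m d"
  show "S + T \<in> Ldeg n m d"
    unfolding Ldeg_def
  proof (intro CollectI allI impI)
    fix J assume "(S + T) J \<noteq> 0"
    then have "S J \<noteq> 0 \<or> T J \<noteq> 0" by auto
    then show "J \<in> tens_index n m \<and> (\<Sum>i=1..n. J i) = d" using ST by (auto simp: Ldeg_def)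
  qed
qed (auto simp: Ldeg_def cscale_def)

lemma sum_fun_upd:
  fixes J :: "'i \<Rightarrow> nat"
  assumes "finite A" "i \<in> A"
  shows "(\<Sum>j\<in>A. (J(i := c)) j) + J i = (\<Sum>j\<in>A. J j) + c"
proof -
  have "(\<Sum>j\<in>A - {i}. (J(i := c)) j) = (\<Sum>j\<in>A - {i}. J j)" by (intro sum.cong) auto
  then show ?thesis
    using sum.remove[OF assms, of "J(i := c)"] sum.remove[OF assms, of J] by simp
qed

lemma Ldeg_slot_f:
  assumes T: "T \<in> Ldeg n m d" and i: "i \<in> {1..n}"
  shows "slot_f m i T \<in> Ldeg n m (Suc d)"
  unfolding Ldeg_def
proof (intro CollectI allI impI)
  fix J assume "slot_f m i T J \<noteq> 0"
  then have J: "1 \<le> J i" "J i \<le> m i" "T (J(i := J i - 1)) \<noteq> 0"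
    by (auto simp: slot_f_apply split: if_splits)
  then have K: "J(i := J i - 1) \<in> tens_index n m" "(\<Sum>j=1..n. (J(i := J i - 1)) j) = d"
    using T by (auto simp: Ldeg_def)
  have "J \<in> tens_index n m"
    using K(1) J(2) i unfolding tens_index_def PiE_iff extensional_def
    by (auto split: if_splits)
  moreover have "(\<Sum>j=1..n. J j) = Suc d"
    using sum_fun_upd[OF _ i, of J "J i - 1"] K(2) J(1) by simp
  ultimately show "J \<in> tens_index n m \<and> (\<Sum>j=1..n. J j) = Suc d" ..
qed

lemma Ldeg_slot_e:
  assumes T: "T \<in> Ldeg n m (Suc d)" and i: "i \<in> {1..n}"
  shows "slot_e m i T \<in> Ldeg n m d"
  unfolding Ldeg_def
proof (intro CollectI allI impI)
  fix J assume "slot_e m i T J \<noteq> 0"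
  then have J: "J i < m i" "T (J(i := J i + 1)) \<noteq> 0"
    by (auto simp: slot_e_apply split: if_splits)
  then have K: "J(i := J i + 1) \<in> tens_index n m" "(\<Sum>j=1..n. (J(i := J i + 1)) j) = Suc d"
    using T by (auto simp: Ldeg_def)
  have "J \<in> tens_index n m"
    using K(1) J(1) i unfolding tens_index_def PiE_iff extensional_def
    by (auto split: if_splits)
  moreover have "(\<Sum>j=1..n. J j) = d"
    using sum_fun_upd[OF _ i, of J "J i + 1"] K(2) by simp
  ultimately show "J \<in> tens_index n m \<and> (\<Sum>j=1..n. J j) = d" ..
qed

lemma Ldeg_0_slot_e:
  assumes T: "T \<in> Ldeg n m 0" and i: "i \<in> {1..n}"
  shows "slot_e m i T = 0"
proof
  fix J :: "nat \<Rightarrow> nat"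
  have "(\<Sum>j=1..n. (J(i := J i + 1)) j) \<noteq> 0"
    using sum_fun_upd[OF finite_atLeastAtMost i, of J "J i + 1"] by linarith
  then have "T (J(i := J i + 1)) = 0" using T by (auto simp: Ldeg_def simp del: sum_eq_0_iff)
  then show "slot_e m i T J = 0 J" by (simp add: slot_e_apply)
qed

lemma Ldeg_slot_h:
  assumes T: "T \<in> Ldeg n m d"
  shows "(\<Sum>i=1..n. slot_h m i T) = cscale (of_nat (\<Sum>i=1..n. m i) - 2 * of_nat d) T"
proof
  fix J
  show "(\<Sum>i=1..n. slot_h m i T) J = cscale (of_nat (\<Sum>i=1..n. m i) - 2 * of_nat d) T J"
  proof (cases "T J = 0")
    case False
    then have J: "J \<in> tens_index n m" "(\<Sum>i=1..n. J i) = d" using T by (auto simp: Ldeg_def)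
    have "(\<Sum>i=1..n. slot_h m i T) J = (\<Sum>i=1..n. (of_nat (m i) - 2 * of_nat (J i)) * T J)"
      unfolding sum_fun_apply using J(1)
      by (intro sum.cong) (auto simp: slot_h_apply tens_index_def PiE_iff)
    also have "\<dots> = (of_nat (\<Sum>i=1..n. m i) - 2 * of_nat (\<Sum>i=1..n. J i)) * T J"
      by (simp add: sum_subtractf sum_distrib_left flip: sum_distrib_right)
    finally show ?thesis unfolding J(2) cscale_def .
  qed (simp add: sum_fun_apply slot_h_apply cscale_def cong: if_cong)
qed

section \<open>Injectivity of the lowering operators\<close>

text \<open>The operators \<open>F = \<Sum>\<^sub>i \<rho>\<^sub>i f\<^sub>i\<close> and \<open>E = \<Sum>\<^sub>i \<rho>\<^sub>i\<^sup>-\<^sup>1 e\<^sub>i\<close> satisfy \<open>[E, F] = \<Sum>\<^sub>i h\<^sub>i\<close>. If \<open>F T = 0\<close> and \<open>T\<close> has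
  weight \<open>\<lambda> > 0\<close>, then \<open>(\<lambda> + F E) T = 0\<close>. More generally \<open>(c + F E) T = 0\<close> with \<open>c > 0\<close> forces \<open>T = 0\<close>
  in nonnegative weight: applying \<open>E\<close> gives \<open>(c' + F E) (E T) = 0\<close>, where \<open>c'\<close> is \<open>c\<close> plus the
  weight of \<open>E T\<close>. By induction on the degree \<open>E T = 0\<close>, so \<open>c T = 0\<close>.\<close>

lemma lowering_injective:
  assumes T: "T \<in> Ldeg n m d" and d: "2 * d < (\<Sum>i=1..n. m i)"
    and \<rho>: "\<And>i. i \<in> {1..n} \<Longrightarrow> \<rho> i \<noteq> 0"
    and ker: "(\<Sum>i=1..n. cscale (\<rho> i) (slot_f m i T)) = 0"
  shows "T = 0"
proof -
  interpret sl2_chain "{1..n}" "slot_e m" "slot_f m" "slot_h m" by (rule sl2_chain_slots)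
  define fr where "fr T = (\<Sum>i=1..n. cscale (\<rho> i) (slot_f m i T))" for T
  define er where "er T = (\<Sum>i=1..n. cscale (1 / \<rho> i) (slot_e m i T))" for T
  have er_fr: "er (fr T) = fr (er T) + (\<Sum>i=1..n. slot_h m i T)" for T
  proof -
    have "er (fr T) = (\<Sum>i=1..n. \<Sum>j=1..n. cscale (1 / \<rho> i) (cscale (\<rho> j) (slot_f m j (slot_e m i T)))
        + cscale (1 / \<rho> i) (cscale (\<rho> j) (if i = j then slot_h m i T else 0)))"
      by (simp add: er_def fr_def lin_e e_f cfun.scale_sum_right cfun.scale_right_distrib)
    also have "\<dots> = (\<Sum>i=1..n. \<Sum>j=1..n. cscale (1 / \<rho> i) (cscale (\<rho> j) (slot_f m j (slot_e m i T))))
        + (\<Sum>i=1..n. \<Sum>j=1..n. cscale (1 / \<rho> i) (cscale (\<rho> j) (if i = j then slot_h m i T else 0)))"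
      by (simp add: sum.distrib)
    also have "(\<Sum>i=1..n. \<Sum>j=1..n. cscale (1 / \<rho> i) (cscale (\<rho> j) (slot_f m j (slot_e m i T))))
        = fr (er T)"
      unfolding fr_def er_def
      by (subst sum.swap) (simp add: lin_f cfun.scale_sum_right mult.commute)
    also have "(\<Sum>i=1..n. \<Sum>j=1..n. cscale (1 / \<rho> i) (cscale (\<rho> j) (if i = j then slot_h m i T else 0)))
        = (\<Sum>i=1..n. \<Sum>j=1..n. if i = j then slot_h m i T else 0)"
      using \<rho> by (intro sum.cong refl) auto
    also have "\<dots> = (\<Sum>i=1..n. slot_h m i T)" by simp
    finally show ?thesis .
  qed
  have er_add: "er (S + T) = er S + er T" "er (cscale c T) = cscale c (er T)" "er 0 = 0" for S T c
    by (simp_all add: er_def lin_e cfun.scale_right_distrib sum.distrib cfun.scale_sum_right mult.commute)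
  define wt where "wt d = real (\<Sum>i=1..n. m i) - 2 * real d" for d
  have h_sum: "(\<Sum>i=1..n. slot_h m i S) = cscale (of_real (wt d)) S" if "S \<in> Ldeg n m d" for S d
    using Ldeg_slot_h[OF that] by (simp add: wt_def)
  have fr_0: "fr 0 = 0" by (simp add: fr_def lin_f)
  have core: "T = 0" if "T \<in> Ldeg n m d" "c > 0" "2 * d \<le> (\<Sum>i=1..n. m i)"
    "cscale (of_real c) T + fr (er T) = 0" for T and c :: real and d
    using that
  proof (induction d arbitrary: T c)
    case 0
    have "er T = 0" unfolding er_def using Ldeg_0_slot_e[OF 0(1)] by simp
    then have "cscale (of_real c) T = 0" using 0(4) fr_0 by (simp only: add_0_right)
    then show ?case using 0(2) by (auto simp only: cfun.scale_eq_0_iff of_real_eq_0_iff)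
  next
    case (Suc d)
    have S: "er T \<in> Ldeg n m d"
      unfolding er_def using Suc.prems(1)
      by (intro cfun.subspace_sum cfun.subspace_scale Ldeg_subspace Ldeg_slot_e)
    have "0 = er (cscale (of_real c) T + fr (er T))" unfolding Suc.prems(4) er_add(3) ..
    also have "\<dots> = cscale (of_real c) (er T) + (fr (er (er T)) + cscale (of_real (wt d)) (er T))"
      unfolding er_add er_fr h_sum[OF S] ..
    also have "\<dots> = cscale (of_real (c + wt d)) (er T) + fr (er (er T))"
      unfolding of_real_add cfun.scale_left_distrib by (simp only: add_ac)
    finally have *: "cscale (of_real (c + wt d)) (er T) + fr (er (er T)) = 0" by (rule sym)
    have "er T = 0"
    proof (rule Suc.IH[OF S _ _ *])
      show "c + wt d > 0" using Suc.prems(2,3) by (simp add: wt_def flip: of_nat_sum)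
      show "2 * d \<le> (\<Sum>i=1..n. m i)" using Suc.prems(3) by simp
    qed
    then have "cscale (of_real c) T = 0" using Suc.prems(4) fr_0 by (simp only: add_0_right)
    then show ?case using Suc.prems(2) by (auto simp only: cfun.scale_eq_0_iff of_real_eq_0_iff)
  qed
  have "fr T = 0" using ker by (simp add: fr_def)
  then have "cscale (of_real (wt d)) T + fr (er T) = 0"
    using er_fr[of T] unfolding h_sum[OF T] by (simp only: er_add(3) add.commute)
  then show ?thesis
    using d by (intro core[OF T, of "wt d"]) (simp_all add: wt_def flip: of_nat_sum)
qed

section \<open>Linear independence and orbits\<close>

text \<open>In a vanishing combination, apply \<open>H\<^sub>i - E\<^sub>i(y)\<close> to remove the term of \<open>y\<close>, with \<open>i\<close> chosen so
  that the coefficient of a given other term is multiplied by a nonzero number. The vectors are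
  indexed by a set, so that injectivity of the indexing is part of the result.\<close>

lemma joint_eigenvectors_independent:
  fixes X :: "'p set" and Psi :: "'p \<Rightarrow> 'a \<Rightarrow> complex" and E :: "'p \<Rightarrow> 'i \<Rightarrow> complex"
  assumes hom: "\<And>i. i \<in> I \<Longrightarrow> module_hom cscale cscale (H i)"
    and nz: "\<And>x. x \<in> X \<Longrightarrow> Psi x \<noteq> 0"
    and eig: "\<And>x i. x \<in> X \<Longrightarrow> i \<in> I \<Longrightarrow> H i (Psi x) = cscale (E x i) (Psi x)"
    and sep: "\<And>x y. x \<in> X \<Longrightarrow> y \<in> X \<Longrightarrow> (\<And>i. i \<in> I \<Longrightarrow> E x i = E y i) \<Longrightarrow> x = y"
  shows "inj_on Psi X" "cfun.independent (Psi ` X)"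
proof -
  have zero: "\<forall>x\<in>Y. u x = 0"
    if "finite Y" "Y \<subseteq> X" "(\<Sum>x\<in>Y. cscale (u x) (Psi x)) = 0" for Y u
    using that
  proof (induction Y arbitrary: u rule: finite_induct)
    case (insert y Y)
    have Y: "u x = 0" if x: "x \<in> Y" for x
    proof -
      have "x \<noteq> y" using x insert by auto
      then obtain i where i: "i \<in> I" "E x i \<noteq> E y i" using sep[of x y] x insert.prems by blast
      have s: "(\<Sum>x\<in>insert y Y. cscale (u x * E x i) (Psi x)) = 0"
      proof -
        have "(\<Sum>x\<in>insert y Y. cscale (u x * E x i) (Psi x))
            = (\<Sum>x\<in>insert y Y. H i (cscale (u x) (Psi x)))"
          using eig[OF _ i(1)] insert.prems(1)
          by (intro sum.cong) (auto simp: module_hom.scale[OF hom[OF i(1)]])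
        also have "\<dots> = H i (\<Sum>x\<in>insert y Y. cscale (u x) (Psi x))"
          by (simp add: module_hom.sum[OF hom[OF i(1)]])
        finally show ?thesis
          unfolding insert.prems(2) module_hom.zero[OF hom[OF i(1)]] .
      qed
      have "(\<Sum>x\<in>insert y Y. cscale (u x * (E x i - E y i)) (Psi x))
          = (\<Sum>x\<in>insert y Y. cscale (u x * E x i) (Psi x))
            - cscale (E y i) (\<Sum>x\<in>insert y Y. cscale (u x) (Psi x))"
        by (simp only: right_diff_distrib cfun.scale_left_diff_distrib sum_subtractf
            cfun.scale_sum_right cfun.scale_scale mult.commute)
      also have "\<dots> = 0" unfolding s insert.prems(2) by simp
      finally have "(\<Sum>x\<in>Y. cscale (u x * (E x i - E y i)) (Psi x)) = 0"
        using insert.hyps by simp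
      then have "u x * (E x i - E y i) = 0"
        using insert.IH[of "\<lambda>x. u x * (E x i - E y i)"] insert.prems(1) x by blast
      then show ?thesis using i(2) by simp
    qed
    then have "(\<Sum>x\<in>Y. cscale (u x) (Psi x)) = 0" by simp
    then have "cscale (u y) (Psi y) = 0"
      using insert.prems(2) unfolding sum.insert[OF insert.hyps] by (simp only: add_0_right)
    then show ?case using Y nz[of y] insert.prems(1) by auto
  qed simp
  show inj: "inj_on Psi X"
  proof (rule inj_onI, rule ccontr)
    fix x y assume xy: "x \<in> X" "y \<in> X" "Psi x = Psi y" "x \<noteq> y"
    define u :: "'p \<Rightarrow> complex" where "u w = (if w = x then 1 else - 1)" for w
    have "(\<Sum>w\<in>{x, y}. cscale (u w) (Psi w)) = 0" using xy by (simp add: u_def)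
    from zero[OF _ _ this] xy show False by (simp add: u_def)
  qed
  show "cfun.independent (Psi ` X)"
    unfolding cfun.independent_explicit_module
  proof (intro allI impI)
    fix S :: "('a \<Rightarrow> complex) set" and u w
    assume S: "finite S" "S \<subseteq> Psi ` X" "(\<Sum>v\<in>S. cscale (u v) v) = 0" "w \<in> S"
    obtain Y where Y: "Y \<subseteq> X" "finite Y" "S = Psi ` Y" using S(1,2) finite_subset_image by metis
    have "(\<Sum>x\<in>Y. cscale (u (Psi x)) (Psi x)) = 0"
      using S(3) inj_on_subset[OF inj Y(1)] unfolding Y(3) by (simp add: sum.reindex)
    from zero[OF Y(2,1) this] show "u w = 0" using S(4) Y(3) by auto
  qed
qed

text \<open>Here \<open>cfun.dim\<close> is the cardinality of a basis, and the functions on a finite set \<open>I\<close> are spanned by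
  finitely many vectors, so that the exchange lemma applies to a basis of \<open>V\<close>.\<close>

lemma card_independent_le_dim:
  assumes I: "finite I" and V: "\<And>w j. w \<in> V \<Longrightarrow> j \<notin> I \<Longrightarrow> w j = 0"
    and S: "S \<subseteq> V" "cfun.independent S"
  shows "finite S \<and> card S \<le> cfun.dim V"
proof -
  obtain B where B: "B \<subseteq> V" "cfun.independent B" "V \<subseteq> cfun.span B" "card B = cfun.dim V"
    using cfun.basis_exists by blast
  have "B \<subseteq> cfun.span (delta ` I)"
  proof
    fix w assume "w \<in> B"
    then have "w = (\<Sum>a\<in>I. cscale (w a) (delta a))" using delta_expansion I V B(1) by blast
    also have "\<dots> \<in> cfun.span (delta ` I)"
      by (intro cfun.span_sum cfun.span_scale cfun.span_base) auto
    finally show "w \<in> cfun.span (delta ` I)" .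
  qed
  then have "finite B" using cfun.independent_span_bound[OF _ B(2)] I by blast
  then show ?thesis using cfun.independent_span_bound[OF _ S(2)] S(1) B(3,4) by force
qed

lemma perm_orbit_image_cong:
  assumes t: "t \<in> cpoints k" "inj_on t {1..k}" and s: "s \<in> cpoints k" "inj_on s {1..k}"
    and eq: "t ` {1..k} = s ` {1..k}"
  shows "perm_orbit k t = perm_orbit k s"
proof -
  have sub: "perm_orbit k t \<subseteq> perm_orbit k s"
    if t: "t \<in> cpoints k" "inj_on t {1..k}" and s: "s \<in> cpoints k" "inj_on s {1..k}"
      and eq: "t ` {1..k} = s ` {1..k}" for t s
  proof -
    define \<tau> where "\<tau> i = (if i \<in> {1..k} then inv_into {1..k} s (t i) else i)" for i
    have mem: "t i \<in> s ` {1..k}" if "i \<in> {1..k}" for i using that eq by blast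
    have s\<tau>: "s (\<tau> i) = t i" for i
    proof (cases "i \<in> {1..k}")
      case True
      then show ?thesis using f_inv_into_f[OF mem[OF True]] by (simp add: \<tau>_def)
    next
      case False
      then show ?thesis
        using s(1) t(1) by (simp add: \<tau>_def cpoints_def PiE_def extensional_def del: atLeastAtMost_iff)
    qed
    have "\<tau> permutes {1..k}"
    proof (rule bij_imp_permutes)
      have "inj_on \<tau> {1..k}"
        by (rule inj_onI) (metis s\<tau> t(2) inj_onD)
      moreover have "\<tau> ` {1..k} \<subseteq> {1..k}"
        using inv_into_into[OF mem] by (auto simp: \<tau>_def)
      ultimately show "bij_betw \<tau> {1..k} {1..k}"
        by (simp add: bij_betw_def endo_inj_surj)
    qed (auto simp: \<tau>_def)
    moreover have "t = s \<circ> \<tau>" using s\<tau> by auto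
    ultimately show ?thesis
      unfolding perm_orbit_def using permutes_compose by (fastforce simp: comp_assoc)
  qed
  show ?thesis using sub[OF t s eq] sub[OF s t eq[symmetric]] by blast
qed

section \<open>Bethe vectors in the tensor product\<close>

lemma bethe_in_Ldeg:
  assumes "finite A" "v \<in> Ldeg n m 0"
  shows "gaudin_chain.bethe {1..n} (slot_f m) z v A \<in> Ldeg n m (card A)"
proof -
  interpret gaudin_chain "{1..n}" "slot_e m" "slot_f m" "slot_h m" z
    by (intro gaudin_chain.intro sl2_chain_slots)
  show ?thesis using assms(1)
  proof (induction A rule: finite_induct)
    case (insert a A)
    show ?case unfolding bethe_insert[OF insert.hyps] fcur_def card_insert_disjoint[OF insert.hyps]
      by (intro cfun.subspace_sum cfun.subspace_scale Ldeg_subspace Ldeg_slot_f insert.IH)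
  qed (simp only: bethe_empty card.empty assms(2))
qed

text \<open>When a point is added to \<open>A\<close>, the lowering operator \<open>f(a)\<close> is applied to a vector of weight
  \<open>|M| - 2 |A|\<close>, which is positive since \<open>2 (|A| + 1) \<le> |M|\<close>.\<close>

lemma bethe_nonzero:
  assumes "finite A" "A \<inter> z ` {1..n} = {}" "2 * card A \<le> (\<Sum>i=1..n. m i)"
    and v: "v \<in> Ldeg n m 0" "v \<noteq> 0"
  shows "gaudin_chain.bethe {1..n} (slot_f m) z v A \<noteq> 0"
proof -
  interpret gaudin_chain "{1..n}" "slot_e m" "slot_f m" "slot_h m" z
    by (intro gaudin_chain.intro sl2_chain_slots)
  show ?thesis using assms(1-3)
  proof (induction A rule: finite_induct)
    case (insert a A)
    show ?case
    proof
      assume "bethe v (insert a A) = 0"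
      then have 0: "(\<Sum>i=1..n. cscale (1 / (a - z i)) (slot_f m i (bethe v A))) = 0"
        by (simp only: bethe_insert[OF insert.hyps] fcur_def)
      have "bethe v A = 0"
      proof (rule lowering_injective[OF bethe_in_Ldeg[OF insert.hyps(1) v(1)] _ _ 0])
        show "2 * card A < (\<Sum>i=1..n. m i)" using insert.prems(2) insert.hyps by simp
        show "1 / (a - z i) \<noteq> 0" if "i \<in> {1..n}" for i using that insert.prems(1) by auto
      qed
      moreover have "bethe v A \<noteq> 0"
        using insert.prems insert.hyps by (intro insert.IH) auto
      ultimately show False by contradiction
    qed
  qed (simp only: bethe_empty v(2) not_False_eq_True)
qed

definition vacuum :: "nat \<Rightarrow> (nat \<Rightarrow> nat) \<Rightarrow> complex" where
  "vacuum n = delta (restrict (\<lambda>_. 0) {1..n})"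

lemma vacuum_Ldeg: "vacuum n \<in> Ldeg n m 0"
  by (auto simp: vacuum_def Ldeg_def delta_def tens_index_def split: if_splits)

lemma vacuum_nonzero: "vacuum n \<noteq> 0"
proof
  assume "vacuum n = 0"
  from fun_cong[OF this, of "restrict (\<lambda>_. 0) {1..n}"] show False
    by (simp add: vacuum_def delta_def)
qed

lemma vacuum_slots:
  assumes "i \<in> {1..n}"
  shows "slot_e m i (vacuum n) = 0" "slot_h m i (vacuum n) = cscale (of_nat (m i)) (vacuum n)"
proof -
  show "slot_e m i (vacuum n) = 0" by (rule Ldeg_0_slot_e[OF vacuum_Ldeg assms])
  show "slot_h m i (vacuum n) = cscale (of_nat (m i)) (vacuum n)"
  proof
    fix J show "slot_h m i (vacuum n) J = cscale (of_nat (m i)) (vacuum n) J"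
      using assms by (simp add: slot_h_apply vacuum_def delta_def cscale_def)
  qed
qed

definition bethe_set :: "nat \<Rightarrow> (nat \<Rightarrow> nat) \<Rightarrow> (nat \<Rightarrow> complex) \<Rightarrow> complex set \<Rightarrow> bool" where
  "bethe_set n m z A \<longleftrightarrow> finite A \<and> A \<inter> z ` {1..n} = {} \<and>
     (\<forall>a\<in>A. (\<Sum>l=1..n. of_nat (m l) / (a - z l)) = (\<Sum>b\<in>A - {a}. 2 / (a - b)))"

lemma critical_point_bethe_set:
  assumes z: "z \<in> Zset n" and t: "t \<in> critical_points n k m z"
  shows "t \<in> cpoints k" "inj_on t {1..k}" "bethe_set n m z (t ` {1..k})"
proof -
  have adm: "t \<in> admissible n k z"
    and eq: "\<And>i. i \<in> {1..k} \<Longrightarrow>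
      (\<Sum>l=1..n. of_nat (m l) / (t i - z l)) = (\<Sum>j\<in>{1..k} - {i}. 2 / (t i - t j))"
    using t unfolding critical_points_eq_Bethe[OF z] by blast+
  show "t \<in> cpoints k" using adm unfolding admissible_def by blast
  show inj: "inj_on t {1..k}" using adm unfolding admissible_def inj_on_def by blast
  have "(\<Sum>l=1..n. of_nat (m l) / (a - z l)) = (\<Sum>b\<in>t ` {1..k} - {a}. 2 / (a - b))"
    if a_mem: "a \<in> t ` {1..k}" for a
  proof -
    obtain i where i: "i \<in> {1..k}" and a: "a = t i" using a_mem by blast
    have "t ` {1..k} - {a} = t ` ({1..k} - {i})"
      using inj_on_image_set_diff[OF inj, of "{1..k}" "{i}"] i unfolding a by simp
    moreover have "inj_on t ({1..k} - {i})" using inj by (rule inj_on_subset) blast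
    ultimately have "(\<Sum>b\<in>t ` {1..k} - {a}. 2 / (a - b)) = (\<Sum>j\<in>{1..k} - {i}. 2 / (t i - t j))"
      unfolding a by (simp only: sum.reindex o_def)
    then show ?thesis using eq[OF i] unfolding a by (simp only:)
  qed
  moreover have "t ` {1..k} \<inter> z ` {1..n} = {}" using adm unfolding admissible_def by blast
  ultimately show "bethe_set n m z (t ` {1..k})" unfolding bethe_set_def by blast
qed

abbreviation bethe_vector ::
  "nat \<Rightarrow> (nat \<Rightarrow> nat) \<Rightarrow> (nat \<Rightarrow> complex) \<Rightarrow> complex set \<Rightarrow> (nat \<Rightarrow> nat) \<Rightarrow> complex" where
  "bethe_vector n m z A \<equiv> gaudin_chain.bethe {1..n} (slot_f m) z (vacuum n) A"

lemma bethe_vector_Sing: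
  assumes z: "inj_on z {1..n}" and A: "bethe_set n m z A"
  shows "bethe_vector n m z A \<in> Sing (card A) n m"
    and "i \<in> {1..n} \<Longrightarrow> gaudin_chain.ham {1..n} (slot_e m) (slot_f m) (slot_h m) z i (bethe_vector n m z A)
      = cscale ((\<Sum>j\<in>{1..n} - {i}. of_nat (m i) * of_nat (m j) / (2 * (z i - z j)))
          - of_nat (m i) * (\<Sum>a\<in>A. 1 / (z i - a))) (bethe_vector n m z A)"
proof -
  interpret gaudin_chain "{1..n}" "slot_e m" "slot_f m" "slot_h m" z
    by (intro gaudin_chain.intro sl2_chain_slots)
  have A': "finite A" "A \<inter> z ` {1..n} = {}" using A by (auto simp: bethe_set_def)
  have be: "weight_sum (\<lambda>i. of_nat (m i)) a - (\<Sum>b\<in>A - {a}. 2 / (a - b)) = 0"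
    "(\<Sum>b\<in>A - {a}. 2 / (a - b)) - weight_sum (\<lambda>i. of_nat (m i)) a = 0" if "a \<in> A" for a
    using that A unfolding bethe_set_def weight_sum_def by simp_all
  have L: "(bethe_vector n m z A) \<in> Ldeg n m (card A)" using bethe_in_Ldeg[OF A'(1) vacuum_Ldeg] .
  have e0: "(\<Sum>i=1..n. slot_e m i (bethe_vector n m z A)) = 0"
    using e_bethe[OF z vacuum_slots A'] by (simp only: be cfun.scale_zero_left sum.neutral_const cong: sum.cong)
  have "tens_action n m sl2_e (bethe_vector n m z A) = 0"
  proof
    fix J show "tens_action n m sl2_e (bethe_vector n m z A) J = 0 J"
      using fun_cong[OF e0, of J] by (simp add: tens_action_def slot_e_def sum_fun_apply)
  qed
  moreover have "tens_action n m sl2_h (bethe_vector n m z A) = cscale (of_nat (\<Sum>i=1..n. m i) - 2 * of_nat (card A)) (bethe_vector n m z A)"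
  proof
    fix J
    have "J \<notin> tens_index n m \<Longrightarrow> (bethe_vector n m z A) J = 0" using L by (auto simp: Ldeg_def)
    then show "tens_action n m sl2_h (bethe_vector n m z A) J = cscale (of_nat (\<Sum>i=1..n. m i) - 2 * of_nat (card A)) (bethe_vector n m z A) J"
      using fun_cong[OF Ldeg_slot_h[OF L], of J]
      by (auto simp: tens_action_def slot_h_def sum_fun_apply cscale_def)
  qed
  ultimately show "(bethe_vector n m z A) \<in> Sing (card A) n m"
    using L by (auto simp: Sing_def Ltens_def Ldeg_def)
  assume i: "i \<in> {1..n}"
  have neg: "(\<Sum>a\<in>A. 1 / (a - z i)) = - (\<Sum>a\<in>A. 1 / (z i - a))"
    by (simp flip: sum_negf) (intro sum.cong refl, simp add: minus_divide_right)
  show "ham i (bethe_vector n m z A)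
      = cscale ((\<Sum>j\<in>{1..n} - {i}. of_nat (m i) * of_nat (m j) / (2 * (z i - z j)))
          - of_nat (m i) * (\<Sum>a\<in>A. 1 / (z i - a))) (bethe_vector n m z A)"
    using ham_bethe[OF z vacuum_slots A' i] unfolding vac_eigenvalue_def neg
    by (simp only: be div_0 cfun.scale_zero_left sum.neutral_const add_0_right mult_minus_right
        add_uminus_conv_diff cong: sum.cong)
qed

section \<open>The bound on the number of orbits\<close>

theorem mainTheorem1:
  fixes n k :: nat and m :: "nat \<Rightarrow> nat"
  assumes "k \<ge> 1"
    and "2 * k \<le> (\<Sum>i=1..n. m i)"
  shows "\<exists>X. proper_algebraic_subset n X \<and>
    (\<forall>z0 \<in> Zset n - X.
       finite (perm_orbit k ` critical_points n k m z0) \<and>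
       card (perm_orbit k ` critical_points n k m z0) \<le> cfun.dim (Sing k n m))"
  \<comment> \<open>The bound is obtained at every point of \<open>Zset n\<close>, so the exceptional set can be empty; as an
    algebraic set it is the zero set of the constant polynomial \<open>1\<close>.\<close>
proof (intro exI[of _ "{}"] conjI ballI)
  have "is_poly_fun n (\<lambda>z. 1)"
    unfolding is_poly_fun_def by (intro exI[of _ "{\<lambda>_. 0}"] exI[of _ "\<lambda>_. 1"]) simp
  then have "algebraic_subset n {}"
    unfolding algebraic_subset_def by (intro exI[of _ "{\<lambda>z. 1}"]) auto
  moreover have "cpoints n \<noteq> {}" by (simp add: cpoints_def PiE_eq_empty_iff)
  ultimately show "proper_algebraic_subset n {}" by (auto simp: proper_algebraic_subset_def)
next
  fix z assume "z \<in> Zset n - {}"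
  then have z: "z \<in> Zset n" and inj: "inj_on z {1..n}" by (auto simp: Zset_def inj_on_def)
  interpret gaudin_chain "{1..n}" "slot_e m" "slot_f m" "slot_h m" z
    by (intro gaudin_chain.intro sl2_chain_slots)
  define C where "C = critical_points n k m z"
  define X where "X = (\<lambda>t. t ` {1..k}) ` C"
  define E where "E A i = (\<Sum>j\<in>{1..n} - {i}. of_nat (m i) * of_nat (m j) / (2 * (z i - z j)))
    - of_nat (m i) * (\<Sum>a\<in>A. 1 / (z i - a))" for A i
  have X: "bethe_set n m z A" "card A = k" if "A \<in> X" for A
    using that critical_point_bethe_set[OF z] by (auto simp: X_def C_def card_image)
  note indep = joint_eigenvectors_independent
    [where I = "{1..n}" and H = ham and X = X and Psi = "bethe_vector n m z" and E = E]
  have hom: "\<And>i. i \<in> {1..n} \<Longrightarrow> module_hom cscale cscale (ham i)" by (rule hom_ham)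
  have nz: "bethe_vector n m z A \<noteq> 0" if "A \<in> X" for A
    using X[OF that] assms(2) by (intro bethe_nonzero vacuum_Ldeg vacuum_nonzero) (auto simp: bethe_set_def)
  have eig: "ham i (bethe_vector n m z A) = cscale (E A i) (bethe_vector n m z A)"
    if "A \<in> X" "i \<in> {1..n}" for A i
    unfolding E_def by (rule bethe_vector_Sing(2)[OF inj X(1)[OF that(1)] that(2)])
  have sep: "A = B" if "A \<in> X" "B \<in> X" "\<And>i. i \<in> {1..n} \<Longrightarrow> E A i = E B i" for A B
    using X[OF that(1)] X[OF that(2)] assms that(3)
    by (intro bethe_eigenvalues_separate[OF inj, of A B m]) (auto simp: bethe_set_def E_def)
  have "finite (bethe_vector n m z ` X) \<and> card (bethe_vector n m z ` X) \<le> cfun.dim (Sing k n m)"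
  proof (rule card_independent_le_dim[OF finite_tens_index])
    show "w J = 0" if "w \<in> Sing k n m" "J \<notin> tens_index n m" for w J
      using that by (auto simp: Sing_def Ltens_def)
    show "bethe_vector n m z ` X \<subseteq> Sing k n m"
      using bethe_vector_Sing(1)[OF inj X(1)] X(2) by auto
    show "cfun.independent (bethe_vector n m z ` X)" using indep(2) hom nz eig sep by blast
  qed
  moreover have "inj_on (bethe_vector n m z) X" using indep(1) hom nz eig sep by blast
  ultimately have finX: "finite X" and cardX: "card X \<le> cfun.dim (Sing k n m)"
    by (auto simp: card_image dest: finite_imageD)
  \<comment> \<open>An orbit depends only on the coordinate set of its points, so there are at most as many
    orbits as coordinate sets.\<close>
  have "perm_orbit k ` C \<subseteq> (\<lambda>A. perm_orbit k (SOME t. t \<in> C \<and> t ` {1..k} = A)) ` X"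
  proof
    fix P assume "P \<in> perm_orbit k ` C"
    then obtain t where t: "t \<in> C" "P = perm_orbit k t" by blast
    define s where "s = (SOME s. s \<in> C \<and> s ` {1..k} = t ` {1..k})"
    have s: "s \<in> C \<and> s ` {1..k} = t ` {1..k}" unfolding s_def by (rule someI[of _ t]) (use t in auto)
    have "P = perm_orbit k s"
      unfolding t(2) using s t(1) critical_point_bethe_set(1,2)[OF z]
      by (intro perm_orbit_image_cong) (auto simp: C_def)
    then show "P \<in> (\<lambda>A. perm_orbit k (SOME t. t \<in> C \<and> t ` {1..k} = A)) ` X"
      using t(1) unfolding X_def s_def by blast
  qed
  then have "finite (perm_orbit k ` C)" "card (perm_orbit k ` C) \<le> card X"
    using finX by (blast intro: finite_subset finite_imageI, intro surj_card_le)
  with cardX show "finite (perm_orbit k ` critical_points n k m z)"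
    "card (perm_orbit k ` critical_points n k m z) \<le> cfun.dim (Sing k n m)"
    by (auto simp: C_def)
qed

end
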